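(* There is an absolute constant $C_0$ such that the following holds. Let $2<s<\infty$, $0<\gamma<1$, $K>0$, let $\alpha$ be an irrational number of bounded type with convergents $p_n/q_n$, and let $C\ge C_0$ and $c>0$. There are $\lambda_0>1$ and $c'>0$, independent of $n$, such that for all $\lambda\ge\lambda_0$ and all $n\ge1$: let $I$ be an interval and $$E(x)=\begin{pmatrix}e_2(x)&0\\0&e_2^{-1}(x)\end{pmatrix}R_{\theta(x)}\begin{pmatrix}e_1(x)&0\\0&e_1^{-1}(x)\end{pmatrix},\qquad x\in I,$$ where $e_1,e_2,\theta\in G^{s,K}(I)$, $e_1,e_2>0$, satisfy $$\inf_{x\in I}\left|\theta(x)-\tfrac{\pi}{2}\right|\ge c\,e^{-q_n^\gamma}\gg\min\left\{\inf_{x\in I}e_1(x),\inf_{x\in I}e_2(x)\right\}^{-\frac1{100}},$$ $$\left|\tfrac1{\cos\theta}\right|_{s,K},\ |\tan\theta|_{s,K}\le Ce^{q_n^\gamma},\qquad |\cos\theta|_{s,K},\ |\cot\theta|_{s,K}\le C,$$ $$|e_i^{-1}|_{s,K}\le C\lambda^{-\frac13q_{n-1}},\quad i=1,2.$$ Put $\eta=\lambda^{-\frac1{4000}q_{n-1}}$ and $e(x)=\|E(x)\|$. Then $$\inf_{x\in I}e(x)\ge c'\inf_{x\in I}e_1(x)\cdot\inf_{x\in I}e_2(x)\cdot e^{-q_n^\gamma},$$ $$|e|_{s,(1+\eta)K}\le C^2|e_1|_{s,K}|e_2|_{s,K},$$ $$|e^{-1}|_{s,(1+\eta)K}\le C^2|e_1^{-1}|_{s,K}|e_2^{-1}|_{s,K}\,e^{q_n^\gamma}.$$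 Moreover, with $s(x)=s(E(x))$ and $u(x)=u(E(x))$, $$\left|\tfrac\pi2-s\right|_{s,(1+\eta)K}\le|e_1^{-1}|_{s,K}^3|e_1|_{s,K}^2,\qquad |u|_{s,(1+\eta)K}\le|e_2^{-1}|_{s,K}^3|e_2|_{s,K}^2 .$$
   Context: For an interval $I$ and smooth $f:I\to\mathbb{R}$, $$|f|_{s,K}=\frac{4\pi^2}{3}\sup_{k\ge0}\frac{(1+k)^2}{K^k(k!)^s}\sup_{x\in I}|\partial^kf(x)|,$$ and $G^{s,K}(I)$ is the set of smooth $f$ with $|f|_{s,K}<\infty$. (The subscript $s$ is the Gevrey exponent, distinct from the angle function $s(x)$.) $e_i^{-1}=1/e_i$ and $e^{-1}=1/e$. $R_\theta=\begin{pmatrix}\cos\theta&-\sin\theta\\\sin\theta&\cos\theta\end{pmatrix}$. For $A\in SL(2,\mathbb{R})$ with $\|A\|>1$ (operator norm), $s(A)\in\mathbb{R}/\pi\mathbb{Z}$ is the angle of the most contracted direction, i.e. a unit vector $\hat s$ in direction $s(A)$ satisfies $\|A\hat s\|=\|A\|^{-1}$; and $u(A)=s(A^{-1})$. Thus $A=R_{u}\,\mathrm{diag}(\|A\|,\|A\|^{-1})\,R_{\frac\pi2-s}$ up to sign. In the last two estimates $s(x)$ is represented by its real value in $[0,\pi)$ and $u(x)$ by its real value in $(-\pi/2,\pi/2]$. An irrational $\alpha$ is of bounded type if $q_{n+1}\le Mq_n$ for all $n$ and some $M>0$. $A\gg B$ for positive quantities means $A\ge C_1B$ for a sufficiently large constant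 $C_1$. *)

theory Defs
  imports "HOL-Analysis.Analysis"
begin

(* Derivatives are taken within I, so they are one-sided at those endpoints that belong to I.
   They are only meaningful when I is a nondegenerate interval. *)
definition deriv_on :: "real set \<Rightarrow> nat \<Rightarrow> (real \<Rightarrow> real) \<Rightarrow> real \<Rightarrow> real" where
  "deriv_on I k f = ((\<lambda>g x. vector_derivative g (at x within I)) ^^ k) f"

definition smooth_on :: "real set \<Rightarrow> (real \<Rightarrow> real) \<Rightarrow> bool" where
  "smooth_on I f \<longleftrightarrow> (\<forall>k. deriv_on I k f differentiable_on I)"

definition gevrey_norm :: "real \<Rightarrow> real \<Rightarrow> real set \<Rightarrow> (real \<Rightarrow> real) \<Rightarrow> ennreal" where
  "gevrey_norm s K I f =
     ennreal (4 * pi\<^sup>2 / 3) *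
     (SUP k. ennreal ((1 + real k)\<^sup>2 / (K ^ k * fact k powr s)) *
             (SUP x\<in>I. ennreal \<bar>deriv_on I k f x\<bar>))"

definition gevrey :: "real \<Rightarrow> real \<Rightarrow> real set \<Rightarrow> (real \<Rightarrow> real) set" where
  "gevrey s K I = {f. smooth_on I f \<and> gevrey_norm s K I f < \<infinity>}"

definition diag2 :: "real \<Rightarrow> real \<Rightarrow> real^2^2" where
  "diag2 a b = vector [vector [a, 0], vector [0, b]]"

definition rot2 :: "real \<Rightarrow> real^2^2" where
  "rot2 t = vector [vector [cos t, - sin t], vector [sin t, cos t]]"

definition opnorm :: "real^2^2 \<Rightarrow> real" where
  "opnorm A = onorm ((*v) A)"

(* t is a real representative of the class s(A) in R/(pi Z). *)
definition contracted_angle :: "real^2^2 \<Rightarrow> real \<Rightarrow> bool" where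
  "contracted_angle A t \<longleftrightarrow> norm (A *v vector [cos t, sin t]) = inverse (opnorm A)"

(* For A in SL(2,R) with opnorm A > 1 each of the following two descriptions determines
   a unique number; s(A) and u(A) = s(A^(-1)) use different fundamental domains. *)
definition s_angle :: "real^2^2 \<Rightarrow> real" where
  "s_angle A = (THE t. 0 \<le> t \<and> t < pi \<and> contracted_angle A t)"

definition u_angle :: "real^2^2 \<Rightarrow> real" where
  "u_angle A = (THE t. - pi / 2 < t \<and> t \<le> pi / 2 \<and> contracted_angle (matrix_inv A) t)"

(* Complete quotients and partial quotients of the continued fraction of an irrational number. *)
primrec cf_complete :: "real \<Rightarrow> nat \<Rightarrow> real" where
  "cf_complete \<alpha> 0 = \<alpha>"
| "cf_complete \<alpha> (Suc n) = 1 / frac (cf_complete \<alpha> n)"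

definition cf_partial :: "real \<Rightarrow> nat \<Rightarrow> int" where
  "cf_partial \<alpha> n = \<lfloor>cf_complete \<alpha> n\<rfloor>"

(* Denominators q_n of the convergents, indexed so that q_0 = 1 and q_1 = a_1. *)
fun cf_denom :: "real \<Rightarrow> nat \<Rightarrow> int" where
  "cf_denom \<alpha> 0 = 1"
| "cf_denom \<alpha> (Suc 0) = cf_partial \<alpha> 1"
| "cf_denom \<alpha> (Suc (Suc n)) =
     cf_partial \<alpha> (Suc (Suc n)) * cf_denom \<alpha> (Suc n) + cf_denom \<alpha> n"

definition bounded_type :: "real \<Rightarrow> bool" where
  "bounded_type \<alpha> \<longleftrightarrow>
     \<alpha> \<notin> \<rat> \<and>
     (\<exists>M>0. \<forall>n. real_of_int (cf_denom \<alpha> (Suc n)) \<le> M * real_of_int (cf_denom \<alpha> n))"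

end

theory Submission
  imports Defs
begin

text \<open>
  The Gevrey norm \<open>N = gevrey_norm s K I\<close> is submultiplicative: this is what the factor
  \<open>(1 + k)\<^sup>2\<close> and the constant \<open>4\<pi>\<^sup>2/3\<close> are made for. It is also complete under absolutely convergent
  sums, so a power series with coefficients of modulus at most \<open>1\<close> and without constant term maps
  a function of norm \<open>r \<le> 1/2\<close> to one of norm at most \<open>2r\<close>. Reciprocals, square roots and the
  arctangent are therefore harmless near \<open>1\<close>, \<open>1\<close> and \<open>0\<close>, and no loss in \<open>K\<close> occurs.

  The second ingredient is explicit linear algebra. Write \<open>y = 1/e\<^sub>1\<close>, \<open>z = 1/e\<^sub>2\<close>. On unit vectors at
  angle \<open>t\<close> the squared length \<open>\<bar>Ev\<bar>\<^sup>2\<close> is \<open>H + X cos 2t + Y sin 2t\<close> with \<open>X\<^sup>2 + Y\<^sup>2 = H\<^sup>2 - 1\<close>. Its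
  maximum gives \<open>\<parallel>E\<parallel> = (sqrt(2H + 2) + sqrt(2H - 2)) / 2\<close>, and factoring \<open>(e\<^sub>1 e\<^sub>2 cos \<theta>)\<^sup>2\<close> out of
  \<open>2H \<plusminus> 2\<close> yields \<open>\<parallel>E\<parallel> = \<bar>cos \<theta>\<bar> e\<^sub>1 e\<^sub>2 (1 + \<Sigma>)\<close>, where \<open>\<Sigma>\<close> is built from polynomials in
  \<open>tan \<theta>\<close>, \<open>1/cos \<theta>\<close>, \<open>y\<close>, \<open>z\<close>, every monomial of which has degree at least \<open>4\<close> in \<open>(y, z)\<close> and at
  most \<open>2\<close> in \<open>(tan \<theta>, 1/cos \<theta>)\<close>. Its minimum is attained at \<open>\<pi>/2 + arctan(Y/X)/2\<close>, and \<open>-Y/X\<close> is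
  \<open>2 tan \<theta> y\<^sup>2\<close> up to a factor close to \<open>1\<close>. The same computation for the rows of \<open>E\<close> exchanges
  \<open>y\<close> and \<open>z\<close> and yields \<open>u\<close>.

  Smallness comes from the gap between \<open>Q = exp(q\<^sub>n\<^sup>\<gamma>)\<close> and \<open>\<lambda>\<close> to the power \<open>-q\<^sub>n\<^sub>-\<^sub>1/3\<close>. As \<open>\<gamma> < 1\<close> and
  \<open>q\<^sub>n \<le> M q\<^sub>n\<^sub>-\<^sub>1\<close>, any fixed power of \<open>Q\<close> is at most exponential in \<open>q\<^sub>n\<^sub>-\<^sub>1\<close>, so a large \<open>\<lambda>\<close>
  beats it uniformly in \<open>n\<close>: with \<open>T = CQ\<close> and \<open>\<epsilon>\<close> the bound on \<open>N y\<close> and \<open>N z\<close> one gets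
  \<open>T\<^sup>2 \<epsilon> \<le> 1/2000\<close> (lemma \<open>bounded_type_small_parameter\<close>). This controls \<open>\<Sigma>\<close>, and both angles have
  norm at most \<open>N y\<close> and \<open>N z\<close> respectively. The form of the angle bounds in the theorem
  follows from \<open>1 = e\<^sub>1 y\<close>, whence \<open>1 \<le> N e\<^sub>1 \<cdot> N y\<close> and \<open>N y \<le> (N y)\<^sup>3 (N e\<^sub>1)\<^sup>2\<close>.
  All this is put together in \<open>product_estimates\<close>.
\<close>

section \<open>Derivatives within an interval\<close>

locale nondegenerate_interval =
  fixes I :: "real set"
  assumes interval: "is_interval I" and interior_nonempty: "interior I \<noteq> {}"
begin

lemma convex: "convex I"
  using interval by (simp add: is_interval_convex)

lemma nonempty: "I \<noteq> {}"
  using interior_nonempty interior_subset by blast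

lemma within_not_bot:
  assumes "x \<in> I"
  shows "at x within I \<noteq> bot"
proof -
  have "I \<noteq> {y}" for y
    using interior_nonempty by auto
  then have "x islimpt I"
    using connected_imp_perfect[of I x] assms interval by (simp add: is_interval_connected_1)
  then show ?thesis
    by (simp add: trivial_limit_within)
qed

end

text \<open>
  A candidate sequence of derivatives. Exhibiting one determines every \<open>deriv_on I k f\<close> on \<open>I\<close> and
  proves smoothness at the same time, so that sums, products and series need no manipulation of
  the choice operator behind \<open>vector_derivative\<close>.
\<close>
definition derivative_tower :: "real set \<Rightarrow> (real \<Rightarrow> real) \<Rightarrow> (nat \<Rightarrow> real \<Rightarrow> real) \<Rightarrow> bool" where
  "derivative_tower I f d \<longleftrightarrow>
     (\<forall>x\<in>I. d 0 x = f x) \<and>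
     (\<forall>k. \<forall>x\<in>I. (d k has_real_derivative d (Suc k) x) (at x within I))"

lemma deriv_on_0: "deriv_on I 0 f = f"
  by (simp add: deriv_on_def)

lemma deriv_on_Suc:
  "deriv_on I (Suc k) f = (\<lambda>x. vector_derivative (deriv_on I k f) (at x within I))"
  by (simp add: deriv_on_def)

context nondegenerate_interval
begin

text \<open>
  Derivatives within \<open>I\<close> are unique because every point of a nondegenerate interval is a limit
  point of it.
\<close>
lemma deriv_on_eq_tower:
  assumes "derivative_tower I f d" "x \<in> I"
  shows "deriv_on I k f x = d k x"
  using assms(2)
proof (induction k arbitrary: x)
  case 0
  then show ?case using assms(1) by (simp add: deriv_on_0 derivative_tower_def)
next
  case (Suc k)
  have "(d k has_real_derivative d (Suc k) x) (at x within I)"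
    using assms(1) Suc.prems by (simp add: derivative_tower_def)
  then have "(deriv_on I k f has_real_derivative d (Suc k) x) (at x within I)"
    by (rule has_field_derivative_transform_within[OF _ zero_less_one Suc.prems])
      (simp add: Suc.IH)
  then show ?case
    unfolding deriv_on_Suc has_real_derivative_iff_has_vector_derivative
    by (rule vector_derivative_within[OF within_not_bot[OF Suc.prems]])
qed

lemma derivative_tower_deriv_on:
  assumes "smooth_on I f"
  shows "derivative_tower I f (\<lambda>k. deriv_on I k f)"
  unfolding derivative_tower_def
proof (intro conjI ballI allI)
  fix k x assume "x \<in> I"
  have "deriv_on I k f differentiable (at x within I)"
    using assms \<open>x \<in> I\<close> by (auto simp: smooth_on_def differentiable_on_def)
  then show "(deriv_on I k f has_real_derivative deriv_on I (Suc k) f x) (at x within I)"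
    unfolding deriv_on_Suc has_real_derivative_iff_has_vector_derivative vector_derivative_def
    by (metis (mono_tags) has_real_derivative_iff_has_vector_derivative real_differentiable_def someI_ex)
qed (simp add: deriv_on_0)

lemma derivative_tower_imp_smooth_on:
  assumes "derivative_tower I f d"
  shows "smooth_on I f"
  unfolding smooth_on_def differentiable_on_def
proof (intro allI ballI)
  fix k x assume "x \<in> I"
  have "(d k has_real_derivative d (Suc k) x) (at x within I)"
    using assms \<open>x \<in> I\<close> by (simp add: derivative_tower_def)
  then have "(deriv_on I k f has_real_derivative d (Suc k) x) (at x within I)"
    by (rule has_field_derivative_transform_within[OF _ zero_less_one \<open>x \<in> I\<close>])
      (simp add: deriv_on_eq_tower[OF assms])
  then show "deriv_on I k f differentiable at x within I"
    by (auto simp: real_differentiable_def)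
qed

end

section \<open>Closure of smoothness on an interval\<close>

text \<open>
  The recursion peels off the first derivative and not the last one. In this form closure under
  products, reciprocals, sine and cosine follows by induction from the differentiation rules alone,
  without formulas for the higher derivatives.
\<close>
primrec times_differentiable :: "real set \<Rightarrow> nat \<Rightarrow> (real \<Rightarrow> real) \<Rightarrow> bool" where
  "times_differentiable I 0 f \<longleftrightarrow> True"
| "times_differentiable I (Suc n) f \<longleftrightarrow>
     (\<exists>f'. (\<forall>x\<in>I. (f has_real_derivative f' x) (at x within I)) \<and> times_differentiable I n f')"

lemma times_differentiable_SucI:
  assumes "\<And>x. x \<in> I \<Longrightarrow> (f has_real_derivative f' x) (at x within I)"
    and "times_differentiable I n f'"
  shows "times_differentiable I (Suc n) f"
  using assms by auto

lemma times_differentiable_cong: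
  assumes "times_differentiable I n f" "\<And>x. x \<in> I \<Longrightarrow> f x = g x"
  shows "times_differentiable I n g"
proof (cases n)
  case (Suc m)
  then obtain f' where f': "\<And>x. x \<in> I \<Longrightarrow> (f has_real_derivative f' x) (at x within I)"
      "times_differentiable I m f'"
    using assms(1) by auto
  have "(g has_real_derivative f' x) (at x within I)" if "x \<in> I" for x
    by (rule has_field_derivative_transform_within[OF f'(1)[OF that] zero_less_one that])
      (simp add: assms(2))
  then show ?thesis using f'(2) Suc by auto
qed simp

lemma times_differentiable_SucD:
  "times_differentiable I (Suc n) f \<Longrightarrow> times_differentiable I n f"
proof (induction n arbitrary: f)
  case (Suc n)
  then obtain f' where "\<forall>x\<in>I. (f has_real_derivative f' x) (at x within I)"
      "times_differentiable I (Suc n) f'"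
    by (metis times_differentiable.simps(2))
  then show ?case
    using Suc.IH[of f'] by auto
qed simp

lemma times_differentiable_add:
  "times_differentiable I n f \<Longrightarrow> times_differentiable I n g \<Longrightarrow>
    times_differentiable I n (\<lambda>x. f x + g x)"
proof (induction n arbitrary: f g)
  case (Suc n)
  obtain f' g' where "\<And>x. x \<in> I \<Longrightarrow> (f has_real_derivative f' x) (at x within I)"
      "times_differentiable I n f'"
      "\<And>x. x \<in> I \<Longrightarrow> (g has_real_derivative g' x) (at x within I)"
      "times_differentiable I n g'"
    using Suc.prems by auto
  then show ?case
    using Suc.IH[of f' g'] by (auto intro!: exI[of _ "\<lambda>x. f' x + g' x"] DERIV_add)
qed simp

lemma times_differentiable_mult:
  "times_differentiable I n f \<Longrightarrow> times_differentiable I n g \<Longrightarrow>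
    times_differentiable I n (\<lambda>x. f x * g x)"
proof (induction n arbitrary: f g)
  case (Suc n)
  obtain f' g' where f': "\<And>x. x \<in> I \<Longrightarrow> (f has_real_derivative f' x) (at x within I)"
      "times_differentiable I n f'"
    and g': "\<And>x. x \<in> I \<Longrightarrow> (g has_real_derivative g' x) (at x within I)"
      "times_differentiable I n g'"
    using Suc.prems by auto
  have "times_differentiable I n (\<lambda>x. f x * g' x + f' x * g x)"
    using f'(2) g'(2) Suc.prems[THEN times_differentiable_SucD]
    by (intro times_differentiable_add Suc.IH)
  with DERIV_mult'[OF f'(1) g'(1)] show ?case
    by (rule times_differentiable_SucI)
qed simp

lemma times_differentiable_const: "times_differentiable I n (\<lambda>x. c)"
proof (induction n arbitrary: c)
  case (Suc n)
  then show ?case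
    using DERIV_const[of c] by (auto intro!: exI[of _ "\<lambda>x. 0"])
qed simp

lemma times_differentiable_inverse:
  assumes "\<And>x. x \<in> I \<Longrightarrow> f x \<noteq> 0"
  shows "times_differentiable I n f \<Longrightarrow> times_differentiable I n (\<lambda>x. 1 / f x)"
proof (induction n)
  case (Suc n)
  obtain f' where f': "\<And>x. x \<in> I \<Longrightarrow> (f has_real_derivative f' x) (at x within I)"
      "times_differentiable I n f'"
    using Suc.prems by auto
  have inv: "times_differentiable I n (\<lambda>x. 1 / f x)"
    using Suc.IH Suc.prems by (blast dest: times_differentiable_SucD)
  have "times_differentiable I n (\<lambda>x. - 1 * (f' x * (1 / f x * (1 / f x))))"
    by (intro times_differentiable_mult times_differentiable_const f'(2) inv)
  from times_differentiable_SucI[OF _ this] show ?case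
  proof this
    fix x assume "x \<in> I"
    then show "((\<lambda>x. 1 / f x) has_real_derivative - 1 * (f' x * (1 / f x * (1 / f x)))) (at x within I)"
      using f'(1)[of x] assms[of x] by (auto intro!: derivative_eq_intros)
  qed
qed simp

text \<open>
  Sine and cosine have to be treated together, since each one is the derivative of the other up to
  sign.
\<close>
lemma times_differentiable_sin_cos:
  "times_differentiable I n f \<Longrightarrow>
    times_differentiable I n (\<lambda>x. sin (f x)) \<and> times_differentiable I n (\<lambda>x. cos (f x))"
proof (induction n)
  case (Suc n)
  obtain f' where f': "\<And>x. x \<in> I \<Longrightarrow> (f has_real_derivative f' x) (at x within I)"
      "times_differentiable I n f'"
    using Suc.prems by auto
  have sc: "times_differentiable I n (\<lambda>x. sin (f x))" "times_differentiable I n (\<lambda>x. cos (f x))"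
    using Suc.IH Suc.prems by (blast dest: times_differentiable_SucD)+
  have "times_differentiable I n (\<lambda>x. f' x * cos (f x))"
    "times_differentiable I n (\<lambda>x. - 1 * (f' x * sin (f x)))"
    by (intro times_differentiable_mult times_differentiable_const f'(2) sc)+
  note td = times_differentiable_SucI[OF _ this(1)] times_differentiable_SucI[OF _ this(2)]
  have "((\<lambda>x. sin (f x)) has_real_derivative f' x * cos (f x)) (at x within I)"
    "((\<lambda>x. cos (f x)) has_real_derivative - 1 * (f' x * sin (f x))) (at x within I)"
    if "x \<in> I" for x
    using f'(1)[OF that] by (auto intro!: derivative_eq_intros)
  then show ?case
    using td by simp
qed simp

context nondegenerate_interval
begin

lemma differentiable_on_deriv_on:
  "times_differentiable I (Suc k) f \<Longrightarrow> deriv_on I k f differentiable_on I"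
proof (induction k arbitrary: f)
  case 0
  then show ?case
    by (auto simp: deriv_on_0 differentiable_on_def real_differentiable_def)
next
  case (Suc k)
  obtain f' where f': "\<And>x. x \<in> I \<Longrightarrow> (f has_real_derivative f' x) (at x within I)"
      "times_differentiable I (Suc k) f'"
    using Suc.prems by (metis times_differentiable.simps(2))
  have "f' x = vector_derivative f (at x within I)" if "x \<in> I" for x
    using f'(1)[OF that] unfolding has_real_derivative_iff_has_vector_derivative
    by (rule vector_derivative_within[OF within_not_bot[OF that], symmetric])
  then have "times_differentiable I (Suc k) (\<lambda>x. vector_derivative f (at x within I))"
    by (rule times_differentiable_cong[OF f'(2)])
  moreover have "deriv_on I (Suc k) f = deriv_on I k (\<lambda>x. vector_derivative f (at x within I))"
    unfolding deriv_on_def funpow_Suc_right by simp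
  ultimately show ?case
    using Suc.IH by simp
qed

lemma smooth_on_iff_times_differentiable:
  "smooth_on I f \<longleftrightarrow> (\<forall>n. times_differentiable I n f)"
proof
  assume "smooth_on I f"
  then have "derivative_tower I f (\<lambda>k. deriv_on I k f)"
    by (rule derivative_tower_deriv_on)
  then have "times_differentiable I n (deriv_on I k f)" for n k
  proof (induction n arbitrary: k)
    case (Suc n)
    then show ?case
      using \<open>derivative_tower I f (\<lambda>k. deriv_on I k f)\<close>
      by (intro times_differentiable_SucI[of I _ "deriv_on I (Suc k) f"])
        (simp_all add: derivative_tower_def)
  qed simp
  from this[of _ 0] show "\<forall>n. times_differentiable I n f"
    by (simp add: deriv_on_0)
qed (simp only: smooth_on_def differentiable_on_deriv_on simp_thms)

lemma smooth_on_inverse: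
  assumes "smooth_on I f" "\<And>x. x \<in> I \<Longrightarrow> f x \<noteq> 0"
  shows "smooth_on I (\<lambda>x. 1 / f x)"
  using assms times_differentiable_inverse by (simp add: smooth_on_iff_times_differentiable)

lemma smooth_on_cos: "smooth_on I f \<Longrightarrow> smooth_on I (\<lambda>x. cos (f x))"
  using times_differentiable_sin_cos by (simp add: smooth_on_iff_times_differentiable)

lemma smooth_on_tan:
  assumes "smooth_on I f" "\<And>x. x \<in> I \<Longrightarrow> cos (f x) \<noteq> 0"
  shows "smooth_on I (\<lambda>x. tan (f x))"
proof -
  have "times_differentiable I n (\<lambda>x. sin (f x) * (1 / cos (f x)))" for n
    using assms times_differentiable_sin_cos
    by (intro times_differentiable_mult times_differentiable_inverse)
      (auto simp: smooth_on_iff_times_differentiable)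
  then show ?thesis
    by (simp add: smooth_on_iff_times_differentiable tan_def)
qed

end

section \<open>The Gevrey norm as an algebra norm\<close>

abbreviation gevrey_const :: real where
  "gevrey_const \<equiv> 4 * pi\<^sup>2 / 3"

text \<open>
  The largest \<open>k\<close>-th derivative that a function of Gevrey norm \<open>1\<close> can have.
\<close>
definition gevrey_weight :: "real \<Rightarrow> real \<Rightarrow> nat \<Rightarrow> real" where
  "gevrey_weight s K k = K ^ k * fact k powr s / (gevrey_const * (1 + real k)\<^sup>2)"

text \<open>
  A smooth function of norm at most \<open>B\<close> (see \<open>gevrey_bound_iff\<close>), in a form that combines
  smoothness and the norm bound and stays within the real numbers.
\<close>
definition gevrey_bound :: "real \<Rightarrow> real \<Rightarrow> real set \<Rightarrow> (real \<Rightarrow> real) \<Rightarrow> real \<Rightarrow> bool" where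
  "gevrey_bound s K I f B \<longleftrightarrow>
     (\<exists>d. derivative_tower I f d \<and> (\<forall>k. \<forall>x\<in>I. \<bar>d k x\<bar> \<le> B * gevrey_weight s K k))"

lemma gevrey_weight_pos: "0 < K \<Longrightarrow> 0 < gevrey_weight s K k"
  by (simp add: gevrey_weight_def)

lemma gevrey_norm_le_iff:
  assumes "0 < K" "0 \<le> B"
  shows "gevrey_norm s K I f \<le> ennreal B \<longleftrightarrow>
    (\<forall>k. \<forall>x\<in>I. \<bar>deriv_on I k f x\<bar> \<le> B * gevrey_weight s K k)"
proof -
  have "ennreal gevrey_const * (ennreal ((1 + real k)\<^sup>2 / (K ^ k * fact k powr s)) * ennreal y) \<le> ennreal B
      \<longleftrightarrow> y \<le> B * gevrey_weight s K k" if "0 \<le> y" for k y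
  proof -
    have "ennreal gevrey_const * (ennreal ((1 + real k)\<^sup>2 / (K ^ k * fact k powr s)) * ennreal y)
       = ennreal (y / gevrey_weight s K k)"
      using assms(1) that by (simp add: gevrey_weight_def ennreal_mult'[symmetric] ac_simps)
    then show ?thesis
      using assms gevrey_weight_pos[OF assms(1), of s k] by (simp add: pos_divide_le_eq)
  qed
  then show ?thesis
    by (simp add: gevrey_norm_def SUP_mult_left_ennreal SUP_le_iff)
qed

context nondegenerate_interval
begin

lemma gevrey_bound_iff:
  assumes "0 < K" "0 \<le> B"
  shows "gevrey_bound s K I f B \<longleftrightarrow> f \<in> gevrey s K I \<and> gevrey_norm s K I f \<le> ennreal B"
proof
  assume "gevrey_bound s K I f B"
  then obtain d where d: "derivative_tower I f d"
      "\<And>k x. x \<in> I \<Longrightarrow> \<bar>d k x\<bar> \<le> B * gevrey_weight s K k"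
    by (auto simp: gevrey_bound_def)
  have le: "gevrey_norm s K I f \<le> ennreal B"
    unfolding gevrey_norm_le_iff[OF assms] using d deriv_on_eq_tower[OF d(1)] by simp
  moreover have "gevrey_norm s K I f < \<infinity>"
    using le ennreal_less_top order.strict_trans1 by fastforce
  ultimately show "f \<in> gevrey s K I \<and> gevrey_norm s K I f \<le> ennreal B"
    using derivative_tower_imp_smooth_on[OF d(1)] by (simp add: gevrey_def)
next
  assume "f \<in> gevrey s K I \<and> gevrey_norm s K I f \<le> ennreal B"
  then show "gevrey_bound s K I f B"
    unfolding gevrey_bound_def gevrey_norm_le_iff[OF assms]
    using derivative_tower_deriv_on[of f] by (auto simp: gevrey_def)
qed

lemma gevrey_bound_enn2real:
  assumes "0 < K" "f \<in> gevrey s K I"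
  shows "gevrey_bound s K I f (enn2real (gevrey_norm s K I f))"
  using assms by (simp add: gevrey_bound_iff gevrey_def)

lemma gevrey_bound_nonneg:
  assumes "0 < K" "gevrey_bound s K I f B"
  shows "0 \<le> B"
proof -
  obtain x where "x \<in> I" using nonempty by auto
  then obtain y where "\<bar>y :: real\<bar> \<le> B * gevrey_weight s K 0"
    using assms(2) by (auto simp: gevrey_bound_def)
  then have "0 \<le> B * gevrey_weight s K 0"
    by linarith
  then show ?thesis
    using gevrey_weight_pos[OF assms(1), of s 0] by (simp add: zero_le_mult_iff)
qed

end

lemma one_le_gevrey_const: "1 \<le> gevrey_const"
proof -
  have "1 \<le> pi\<^sup>2"
    using pi_ge_two by (intro one_le_power) simp
  then show ?thesis by simp
qed

lemma gevrey_const_le: "gevrey_const \<le> 22"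
proof -
  have "pi\<^sup>2 \<le> 4\<^sup>2"
    using pi_less_4 by (intro power_mono) auto
  then show ?thesis by simp
qed

lemma gevrey_weight_0: "gevrey_weight s K 0 = 1 / gevrey_const"
  by (simp add: gevrey_weight_def)

lemma gevrey_bound_abs_le:
  assumes "gevrey_bound s K I f B" "x \<in> I"
  shows "\<bar>f x\<bar> \<le> B / gevrey_const"
proof -
  have "\<bar>f x\<bar> \<le> B * gevrey_weight s K 0"
    using assms unfolding gevrey_bound_def derivative_tower_def by metis
  then show ?thesis by (simp add: gevrey_weight_0)
qed

lemma gevrey_bound_cong:
  assumes "gevrey_bound s K I f B" "\<And>x. x \<in> I \<Longrightarrow> f x = g x"
  shows "gevrey_bound s K I g B"
  using assms by (auto simp: gevrey_bound_def derivative_tower_def)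

lemma gevrey_bound_mono:
  assumes "gevrey_bound s K I f B" "B \<le> B'" "0 < K"
  shows "gevrey_bound s K I f B'"
proof -
  have "B * gevrey_weight s K k \<le> B' * gevrey_weight s K k" for k
    using assms(2) gevrey_weight_pos[OF assms(3), of s k] by simp
  then show ?thesis
    using assms(1) unfolding gevrey_bound_def by (meson order_trans)
qed

lemma gevrey_bound_increase_K:
  assumes "gevrey_bound s K I f B" "0 < K" "K \<le> K'" "0 \<le> B"
  shows "gevrey_bound s K' I f B"
proof -
  have "gevrey_weight s K k \<le> gevrey_weight s K' k" for k
    unfolding gevrey_weight_def using assms
    by (intro divide_right_mono mult_right_mono power_mono) auto
  then have "B * gevrey_weight s K k \<le> B * gevrey_weight s K' k" for k
    using assms(4) by (simp add: mult_left_mono)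
  then show ?thesis
    using assms(1) unfolding gevrey_bound_def by (meson order_trans)
qed

lemma gevrey_bound_const:
  assumes "0 < K" "B \<ge> gevrey_const * \<bar>a\<bar>"
  shows "gevrey_bound s K I (\<lambda>x. a) B"
proof -
  have "derivative_tower I (\<lambda>x. a) (\<lambda>k x. if k = 0 then a else 0)"
    by (auto simp: derivative_tower_def)
  moreover have "\<bar>if k = 0 then a else 0\<bar> \<le> B * gevrey_weight s K k" for k
  proof -
    have B: "0 \<le> B"
      using assms(2) one_le_gevrey_const by (smt (verit) mult_nonneg_nonneg)
    have "gevrey_const * \<bar>a\<bar> / gevrey_const \<le> B / gevrey_const"
      using assms(2) by (intro divide_right_mono) auto
    then show ?thesis
      using B less_imp_le[OF gevrey_weight_pos[OF assms(1), of s k]] by (auto simp: gevrey_weight_0)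
  qed
  ultimately show ?thesis
    unfolding gevrey_bound_def by (intro exI[of _ "\<lambda>k x. if k = 0 then a else 0"]) auto
qed

lemma gevrey_bound_add:
  assumes "gevrey_bound s K I f A" "gevrey_bound s K I g B"
  shows "gevrey_bound s K I (\<lambda>x. f x + g x) (A + B)"
proof -
  obtain d where d: "derivative_tower I f d"
      "\<And>k x. x \<in> I \<Longrightarrow> \<bar>d k x\<bar> \<le> A * gevrey_weight s K k"
    using assms(1) by (auto simp: gevrey_bound_def)
  obtain d' where d': "derivative_tower I g d'"
      "\<And>k x. x \<in> I \<Longrightarrow> \<bar>d' k x\<bar> \<le> B * gevrey_weight s K k"
    using assms(2) by (auto simp: gevrey_bound_def)
  have "derivative_tower I (\<lambda>x. f x + g x) (\<lambda>k x. d k x + d' k x)"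
    using d(1) d'(1) by (auto simp: derivative_tower_def intro: DERIV_add)
  moreover have "\<bar>d k x + d' k x\<bar> \<le> (A + B) * gevrey_weight s K k" if "x \<in> I" for k x
    using d(2)[OF that, of k] d'(2)[OF that, of k] by (simp add: distrib_right)
  ultimately show ?thesis
    unfolding gevrey_bound_def by blast
qed

lemma gevrey_bound_scale:
  assumes "gevrey_bound s K I f A"
  shows "gevrey_bound s K I (\<lambda>x. c * f x) (\<bar>c\<bar> * A)"
proof -
  obtain d where d: "derivative_tower I f d"
      "\<And>k x. x \<in> I \<Longrightarrow> \<bar>d k x\<bar> \<le> A * gevrey_weight s K k"
    using assms(1) by (auto simp: gevrey_bound_def)
  have "derivative_tower I (\<lambda>x. c * f x) (\<lambda>k x. c * d k x)"
    using d(1) by (auto simp: derivative_tower_def intro: DERIV_cmult)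
  moreover have "\<bar>c * d k x\<bar> \<le> \<bar>c\<bar> * A * gevrey_weight s K k" if "x \<in> I" for k x
    using d(2)[OF that, of k] by (simp add: abs_mult mult.assoc mult_left_mono)
  ultimately show ?thesis
    unfolding gevrey_bound_def by blast
qed

lemma gevrey_bound_diff:
  assumes "gevrey_bound s K I f A" "gevrey_bound s K I g B"
  shows "gevrey_bound s K I (\<lambda>x. f x - g x) (A + B)"
  using gevrey_bound_add[OF assms(1) gevrey_bound_scale[OF assms(2), of "-1"]] by simp

text \<open>
  The general Leibniz rule.
\<close>
lemma derivative_tower_mult:
  assumes "derivative_tower I f d" "derivative_tower I g d'"
  shows "derivative_tower I (\<lambda>x. f x * g x)
           (\<lambda>k x. \<Sum>j\<le>k. real (k choose j) * d j x * d' (k - j) x)"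
  unfolding derivative_tower_def
proof (intro conjI ballI allI)
  fix x assume "x \<in> I"
  then show "(\<Sum>j\<le>0. real (0 choose j) * d j x * d' (0 - j) x) = f x * g x"
    using assms by (simp add: derivative_tower_def)
next
  fix k x assume x: "x \<in> I"
  have d: "(d j has_real_derivative d (Suc j) x) (at x within I)"
    and d': "(d' j has_real_derivative d' (Suc j) x) (at x within I)" for j
    using assms x by (auto simp: derivative_tower_def)
  have "((\<lambda>x. \<Sum>j\<le>k. real (k choose j) * d j x * d' (k - j) x) has_real_derivative
      (\<Sum>j\<le>k. real (k choose j) * (d (Suc j) x * d' (k - j) x + d j x * d' (Suc (k - j)) x)))
      (at x within I)"
    by (auto intro!: derivative_eq_intros DERIV_sum d d' simp: algebra_simps)
  also have "(\<Sum>j\<le>k. real (k choose j) * (d (Suc j) x * d' (k - j) x + d j x * d' (Suc (k - j)) x))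
     = (\<Sum>j\<le>k. real (k choose j) * d (Suc j) x * d' (k - j) x)
       + (\<Sum>j\<le>k. real (k choose j) * d j x * d' (Suc k - j) x)"
    by (simp add: sum.distrib[symmetric] algebra_simps Suc_diff_le)
  also have "(\<Sum>j\<le>k. real (k choose j) * d j x * d' (Suc k - j) x)
      = (\<Sum>j\<le>Suc k. real (k choose j) * d j x * d' (Suc k - j) x)"
    by simp
  also have "\<dots> = d 0 x * d' (Suc k) x
      + (\<Sum>j\<le>k. real (k choose Suc j) * d (Suc j) x * d' (k - j) x)"
    by (subst sum.atMost_Suc_shift) simp
  also have "(\<Sum>j\<le>k. real (k choose j) * d (Suc j) x * d' (k - j) x) + \<dots>
      = d 0 x * d' (Suc k) x + (\<Sum>j\<le>k. real (Suc k choose Suc j) * d (Suc j) x * d' (k - j) x)"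
    by (simp add: sum.distrib[symmetric] distrib_right)
  also have "\<dots> = (\<Sum>j\<le>Suc k. real (Suc k choose j) * d j x * d' (Suc k - j) x)"
    by (simp only: sum.atMost_Suc_shift[where n = k] diff_Suc_Suc binomial_n_0 of_nat_1 mult_1 diff_zero)
  finally show "((\<lambda>x. \<Sum>j\<le>k. real (k choose j) * d j x * d' (k - j) x) has_real_derivative
      (\<Sum>j\<le>Suc k. real (Suc k choose j) * d j x * d' (Suc k - j) x)) (at x within I)" .
qed

text \<open>
  The sequence \<open>1/(1 + k)\<^sup>2\<close> is, up to a constant, a convolution algebra: one of the two indices \<open>j\<close>
  and \<open>k - j\<close> is at least \<open>k/2\<close>, and the squares of the reciprocals sum to \<open>\<pi>\<^sup>2/6\<close>.
\<close>
lemma sum_inverse_squares_convolution_le: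
  "(\<Sum>j\<le>k. 1 / ((1 + real j)\<^sup>2 * (1 + real (k - j))\<^sup>2)) \<le> gevrey_const / (1 + real k)\<^sup>2"
proof -
  have term_le: "1 / ((1 + real j)\<^sup>2 * (1 + real (k - j))\<^sup>2)
      \<le> (2 / (1 + real j)\<^sup>2 + 2 / (1 + real (k - j))\<^sup>2) / (1 + real k)\<^sup>2" if "j \<le> k" for j
  proof -
    define u v where "u = 1 + real j" and "v = 1 + real (k - j)"
    have uv: "0 < u" "0 < v" "0 < 1 + real k" "1 + real k \<le> u + v"
      using that by (auto simp: u_def v_def of_nat_diff)
    have "(1 + real k)\<^sup>2 \<le> (u + v)\<^sup>2"
      using uv by (intro power_mono) auto
    also have "\<dots> \<le> 2 * u\<^sup>2 + 2 * v\<^sup>2"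
      using zero_le_power2[of "u - v"] by (simp add: power2_eq_square algebra_simps)
    finally have "(1 + real k)\<^sup>2 / (u\<^sup>2 * v\<^sup>2) \<le> (2 * u\<^sup>2 + 2 * v\<^sup>2) / (u\<^sup>2 * v\<^sup>2)"
      by (rule divide_right_mono) simp
    also have "\<dots> = 2 / u\<^sup>2 + 2 / v\<^sup>2"
      using uv by (simp add: field_simps)
    finally have "(1 + real k)\<^sup>2 * (1 / (u\<^sup>2 * v\<^sup>2)) \<le> 2 / u\<^sup>2 + 2 / v\<^sup>2"
      by simp
    then show ?thesis
      unfolding u_def[symmetric] v_def[symmetric] using uv(3)
      by (subst pos_le_divide_eq) (simp_all add: mult.commute)
  qed
  have half: "(\<Sum>j\<le>k. 2 / (1 + real j)\<^sup>2) \<le> 2 * (pi\<^sup>2 / 6)"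
  proof -
    have "(\<Sum>j\<in>{..k}. 1 / (real j + 1)\<^sup>2) \<le> pi\<^sup>2 / 6"
      using sum_le_suminf[OF sums_summable[OF inverse_squares_sums], of "{..k}"]
        sums_unique[OF inverse_squares_sums] by (simp add: add.commute)
    moreover have "(\<Sum>j\<le>k. 2 / (1 + real j)\<^sup>2) = 2 * (\<Sum>j\<in>{..k}. 1 / (real j + 1)\<^sup>2)"
      by (simp add: sum_distrib_left add.commute)
    ultimately show ?thesis by linarith
  qed
  have "(\<Sum>j\<le>k. 1 / ((1 + real j)\<^sup>2 * (1 + real (k - j))\<^sup>2))
      \<le> (\<Sum>j\<le>k. (2 / (1 + real j)\<^sup>2 + 2 / (1 + real (k - j))\<^sup>2) / (1 + real k)\<^sup>2)"
    by (intro sum_mono term_le) simp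
  also have "\<dots> = ((\<Sum>j\<le>k. 2 / (1 + real j)\<^sup>2) + (\<Sum>j\<le>k. 2 / (1 + real (k - j))\<^sup>2)) / (1 + real k)\<^sup>2"
    by (simp only: sum_divide_distrib sum.distrib add_divide_distrib)
  also have "(\<Sum>j\<le>k. 2 / (1 + real (k - j))\<^sup>2) = (\<Sum>j\<le>k. 2 / (1 + real j)\<^sup>2)"
    using sum.nat_diff_reindex[of "\<lambda>j. 2 / (1 + real j)\<^sup>2" "Suc k"]
    by (simp add: lessThan_Suc_atMost)
  also have "((\<Sum>j\<le>k. 2 / (1 + real j)\<^sup>2) + (\<Sum>j\<le>k. 2 / (1 + real j)\<^sup>2)) / (1 + real k)\<^sup>2
      \<le> gevrey_const / (1 + real k)\<^sup>2"
    using half zero_le_power2[of pi] by (intro divide_right_mono) (linarith, simp)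
  finally show ?thesis .
qed

text \<open>
  Here \<open>s \<ge> 1\<close> enters: the binomial coefficient of the Leibniz rule is absorbed because it is at
  most its own \<open>s\<close>-th power, which turns \<open>(j!)\<^sup>s ((k - j)!)\<^sup>s\<close> into \<open>(k!)\<^sup>s\<close>.
\<close>
lemma gevrey_weight_convolution_le:
  assumes "1 \<le> s" "0 < K"
  shows "(\<Sum>j\<le>k. real (k choose j) * gevrey_weight s K j * gevrey_weight s K (k - j))
    \<le> gevrey_weight s K k"
proof -
  have term_le: "real (k choose j) * gevrey_weight s K j * gevrey_weight s K (k - j)
     \<le> K ^ k * fact k powr s / gevrey_const\<^sup>2 * (1 / ((1 + real j)\<^sup>2 * (1 + real (k - j))\<^sup>2))"
    if "j \<le> k" for j
  proof -
    have "real (k choose j) * (fact j powr s * fact (k - j) powr s) \<le> fact k powr s"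
    proof -
      have "1 \<le> real (k choose j)"
        using that by (simp add: Suc_le_eq)
      then have "real (k choose j) \<le> real (k choose j) powr s"
        using assms(1) powr_mono[of 1 s "real (k choose j)"] by simp
      then have "real (k choose j) * (fact j powr s * fact (k - j) powr s)
          \<le> real (k choose j) powr s * (fact j powr s * fact (k - j) powr s)"
        by (intro mult_right_mono) auto
      also have "\<dots> = (fact j * fact (k - j) * real (k choose j)) powr s"
        by (simp add: powr_mult)
      also have "\<dots> = fact k powr s"
        using binomial_fact_lemma[OF that] by (metis of_nat_fact of_nat_mult)
      finally show ?thesis .
    qed
    then have "real (k choose j) * (fact j powr s * fact (k - j) powr s) *
        (K ^ k / (gevrey_const\<^sup>2 * ((1 + real j)\<^sup>2 * (1 + real (k - j))\<^sup>2)))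
      \<le> fact k powr s * (K ^ k / (gevrey_const\<^sup>2 * ((1 + real j)\<^sup>2 * (1 + real (k - j))\<^sup>2)))"
      using assms(2) by (intro mult_right_mono) auto
    moreover have "K ^ k = K ^ j * K ^ (k - j)"
      using that by (simp flip: power_add)
    ultimately show ?thesis
      by (simp add: gevrey_weight_def power2_eq_square[of gevrey_const] ac_simps)
  qed
  have "(\<Sum>j\<le>k. real (k choose j) * gevrey_weight s K j * gevrey_weight s K (k - j))
     \<le> K ^ k * fact k powr s / gevrey_const\<^sup>2 * (\<Sum>j\<le>k. 1 / ((1 + real j)\<^sup>2 * (1 + real (k - j))\<^sup>2))"
    unfolding sum_distrib_left by (intro sum_mono term_le) simp
  also have "\<dots> \<le> K ^ k * fact k powr s / gevrey_const\<^sup>2 * (gevrey_const / (1 + real k)\<^sup>2)"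
    using assms(2) by (intro mult_left_mono sum_inverse_squares_convolution_le) auto
  also have "\<dots> = gevrey_weight s K k"
    by (simp add: gevrey_weight_def power2_eq_square)
  finally show ?thesis .
qed

lemma gevrey_bound_mult:
  assumes "gevrey_bound s K I f A" "gevrey_bound s K I g B" "1 \<le> s" "0 < K"
  shows "gevrey_bound s K I (\<lambda>x. f x * g x) (A * B)"
proof -
  let ?w = "gevrey_weight s K"
  obtain d where d: "derivative_tower I f d" "\<And>k x. x \<in> I \<Longrightarrow> \<bar>d k x\<bar> \<le> A * ?w k"
    using assms(1) by (auto simp: gevrey_bound_def)
  obtain d' where d': "derivative_tower I g d'" "\<And>k x. x \<in> I \<Longrightarrow> \<bar>d' k x\<bar> \<le> B * ?w k"
    using assms(2) by (auto simp: gevrey_bound_def)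
  have "\<bar>\<Sum>j\<le>k. real (k choose j) * d j x * d' (k - j) x\<bar> \<le> A * B * ?w k" if "x \<in> I" for k x
  proof -
    have "0 \<le> A * ?w 0" "0 \<le> B * ?w 0"
      using d(2)[OF that, of 0] d'(2)[OF that, of 0] by linarith+
    then have AB: "0 \<le> A" "0 \<le> B"
      using gevrey_weight_pos[OF assms(4), of s 0] by (simp_all add: zero_le_mult_iff)
    have "\<bar>real (k choose j) * d j x * d' (k - j) x\<bar>
        \<le> A * B * (real (k choose j) * ?w j * ?w (k - j))" for j
    proof -
      have "\<bar>d j x\<bar> * \<bar>d' (k - j) x\<bar> \<le> (A * ?w j) * (B * ?w (k - j))"
        using d(2)[OF that] d'(2)[OF that] AB(1) less_imp_le[OF gevrey_weight_pos[OF assms(4)]]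
        by (intro mult_mono mult_nonneg_nonneg) auto
      then have "real (k choose j) * (\<bar>d j x\<bar> * \<bar>d' (k - j) x\<bar>)
          \<le> real (k choose j) * ((A * ?w j) * (B * ?w (k - j)))"
        by (rule mult_left_mono) simp
      then show ?thesis
        by (simp add: abs_mult ac_simps)
    qed
    then have "\<bar>\<Sum>j\<le>k. real (k choose j) * d j x * d' (k - j) x\<bar>
        \<le> (\<Sum>j\<le>k. A * B * (real (k choose j) * ?w j * ?w (k - j)))"
      by (intro order_trans[OF sum_abs] sum_mono)
    also have "\<dots> = A * B * (\<Sum>j\<le>k. real (k choose j) * ?w j * ?w (k - j))"
      by (simp add: sum_distrib_left)
    also have "\<dots> \<le> A * B * ?w k"
      using assms AB by (intro mult_left_mono gevrey_weight_convolution_le) auto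
    finally show ?thesis .
  qed
  then show ?thesis
    using derivative_tower_mult[OF d(1) d'(1)] unfolding gevrey_bound_def by blast
qed

lemma gevrey_bound_power:
  assumes "gevrey_bound s K I f A" "1 \<le> s" "0 < K" "0 < n"
  shows "gevrey_bound s K I (\<lambda>x. f x ^ n) (A ^ n)"
  using assms(4)
proof (induction n rule: nat_induct_non_zero)
  case (Suc n)
  then show ?case
    using gevrey_bound_mult[OF assms(1) Suc.IH assms(2,3)] by simp
qed (use assms(1) in simp)

text \<open>
  Completeness of the Gevrey class: the bound makes the series of \<open>k\<close>-th derivatives converge
  uniformly for each \<open>k\<close>, so it may be differentiated term by term.
\<close>
lemma (in nondegenerate_interval) gevrey_bound_sums:
  assumes bound: "\<And>n. gevrey_bound s K I (f n) (B n)"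
    and B: "B sums S" and "0 < K"
    and sums: "\<And>x. x \<in> I \<Longrightarrow> (\<lambda>n. f n x) sums F x"
  shows "gevrey_bound s K I F S"
proof -
  let ?w = "gevrey_weight s K"
  obtain d where d: "\<And>n. derivative_tower I (f n) (d n)"
      and le: "\<And>n k x. x \<in> I \<Longrightarrow> \<bar>d n k x\<bar> \<le> B n * ?w k"
    using bound unfolding gevrey_bound_def by metis
  have summable_B: "(\<lambda>n. B n * ?w k) sums (S * ?w k)" for k
    using B by (rule sums_mult2)
  have summable_d: "summable (\<lambda>n. d n k x)" if "x \<in> I" for k x
    using le[OF that] by (intro summable_comparison_test'[OF sums_summable[OF summable_B[of k]]]) auto
  define D where "D k x = (\<Sum>n. d n k x)" for k x
  have "derivative_tower I F D"
    unfolding derivative_tower_def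
  proof (intro conjI ballI allI)
    fix x assume "x \<in> I"
    then show "D 0 x = F x"
      using d sums[of x] by (simp add: D_def derivative_tower_def sums_iff)
  next
    fix k x assume x: "x \<in> I"
    have "uniform_limit I (\<lambda>N x. \<Sum>n<N. d n (Suc k) x) (D (Suc k)) sequentially"
      unfolding D_def using le
      by (intro Weierstrass_m_test[OF _ sums_summable[OF summable_B[of "Suc k"]]]) auto
    then have "\<exists>g. \<forall>x\<in>I. (\<lambda>n. d n k x) sums g x \<and> (g has_field_derivative D (Suc k) x) (at x within I)"
      using d by (intro has_field_derivative_series[where f' = "\<lambda>n. d n (Suc k)" and ?x0.0 = x] convex x summable_d)
        (auto simp: derivative_tower_def)
    then obtain g where g: "\<And>y. y \<in> I \<Longrightarrow> (\<lambda>n. d n k y) sums g y"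
        "(g has_real_derivative D (Suc k) x) (at x within I)"
      using x by auto
    show "(D k has_real_derivative D (Suc k) x) (at x within I)"
      by (rule has_field_derivative_transform_within[OF g(2) zero_less_one x])
        (simp add: D_def sums_unique[OF g(1)])
  qed
  moreover have "\<bar>D k x\<bar> \<le> S * ?w k" if "x \<in> I" for k x
  proof -
    have abs: "summable (\<lambda>n. \<bar>d n k x\<bar>)"
      using le[OF that] by (intro summable_comparison_test'[OF sums_summable[OF summable_B[of k]]]) auto
    have "\<bar>D k x\<bar> \<le> (\<Sum>n. \<bar>d n k x\<bar>)"
      unfolding D_def by (rule summable_rabs[OF abs])
    also have "\<dots> \<le> (\<Sum>n. B n * ?w k)"
      using le[OF that] by (intro suminf_le abs sums_summable[OF summable_B]) auto
    also have "\<dots> = S * ?w k"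
      using summable_B by (simp add: sums_iff)
    finally show ?thesis .
  qed
  ultimately show ?thesis
    unfolding gevrey_bound_def by blast
qed

section \<open>Power series of small Gevrey functions\<close>

context nondegenerate_interval
begin

text \<open>
  The functional calculus needed below, in a form that covers lacunary series such as that of the
  arctangent: the \<open>n\<close>-th term has norm at most \<open>r\<close> to the power \<open>n + 1\<close>, and the geometric
  series sums to \<open>r/(1 - r) \<le> 2r\<close>.
\<close>
lemma gevrey_bound_small_series:
  assumes g: "gevrey_bound s K I g r" and "1 \<le> s" "0 < K" "r \<le> 1 / 2"
    and a: "\<And>n. \<bar>a n\<bar> \<le> 1" and m: "\<And>n. n \<le> m n"
    and sums: "\<And>x. x \<in> I \<Longrightarrow> (\<lambda>n. a n * g x ^ Suc (m n)) sums F x"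
  shows "gevrey_bound s K I F (2 * r)"
proof -
  have r: "0 \<le> r" "r < 1"
    using gevrey_bound_nonneg[OF \<open>0 < K\<close> g] assms(4) by auto
  have "gevrey_bound s K I (\<lambda>x. a n * g x ^ Suc (m n)) (r ^ Suc n)" for n
  proof (rule gevrey_bound_mono)
    show "gevrey_bound s K I (\<lambda>x. a n * g x ^ Suc (m n)) (\<bar>a n\<bar> * r ^ Suc (m n))"
      using gevrey_bound_power[OF g assms(2,3) zero_less_Suc] by (rule gevrey_bound_scale)
    have "\<bar>a n\<bar> * r ^ Suc (m n) \<le> 1 * r ^ Suc n"
      using r m[of n] a[of n] by (intro mult_mono power_decreasing) auto
    then show "\<bar>a n\<bar> * r ^ Suc (m n) \<le> r ^ Suc n" by simp
  qed (rule assms)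
  moreover have "(\<lambda>n. r ^ Suc n) sums (r * (1 / (1 - r)))"
    using sums_mult[OF geometric_sums[of r], of r] r by simp
  ultimately have "gevrey_bound s K I F (r * (1 / (1 - r)))"
    by (rule gevrey_bound_sums[OF _ _ \<open>0 < K\<close> sums])
  moreover have "r * (1 / (1 - r)) \<le> r * 2"
    using r assms(4) by (intro mult_left_mono) (auto simp: field_simps)
  ultimately show ?thesis
    using gevrey_bound_mono[OF _ _ \<open>0 < K\<close>] by (metis mult.commute)
qed

lemma abs_le_gevrey_bound:
  assumes "gevrey_bound s K I f B" "0 < K" "x \<in> I"
  shows "\<bar>f x\<bar> \<le> B"
proof -
  have "B / gevrey_const \<le> B / 1"
    using one_le_gevrey_const gevrey_bound_nonneg[OF assms(2,1)] by (intro divide_left_mono) auto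
  then show ?thesis
    using gevrey_bound_abs_le[OF assms(1,3)] by simp
qed

lemma sums_minus_constant_term:
  fixes a :: "nat \<Rightarrow> real"
  assumes "(\<lambda>n. a n * z ^ n) sums S"
  shows "(\<lambda>n. a (Suc n) * z ^ Suc n) sums (S - a 0)"
  using assms sums_Suc_iff[of "\<lambda>n. a n * z ^ n" "S - a 0"] by simp

lemma alternating_geometric_sums:
  fixes z :: real
  assumes "\<bar>z\<bar> < 1"
  shows "(\<lambda>n. (- 1) ^ n * z ^ n) sums (1 / (1 + z))"
  using geometric_sums[of "- z"] assms by (simp flip: power_mult_distrib)

lemma gevrey_bound_inverse:
  assumes "gevrey_bound s K I g r" "1 \<le> s" "0 < K" "r \<le> 1 / 2"
  shows "gevrey_bound s K I (\<lambda>x. 1 / (1 + g x) - 1) (2 * r)"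
proof (rule gevrey_bound_small_series[OF assms, where a = "\<lambda>n. (- 1) ^ Suc n" and m = "\<lambda>n. n"])
  fix x assume "x \<in> I"
  then have lt: "\<bar>g x\<bar> < 1"
    using abs_le_gevrey_bound[OF assms(1,3)] assms(4) by fastforce
  show "(\<lambda>n. (- 1) ^ Suc n * g x ^ Suc n) sums (1 / (1 + g x) - 1)"
    using sums_minus_constant_term[OF alternating_geometric_sums[OF lt]] by (simp only: power_0)
qed auto

lemma abs_half_gchoose_le_1: "\<bar>(1 / 2 :: real) gchoose n\<bar> \<le> 1"
proof (induction n)
  case (Suc n)
  have *: "u = v * ((1 / 2 - real n) / real (Suc n))"
    if "1 / 2 * v = real n * v + real (Suc n) * u" for u v :: real
  proof -
    have "u * real (Suc n) = v * (1 / 2 - real n)"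
      using that by (simp only: right_diff_distrib mult.commute[of u] mult.commute[of v])
    then have "u = v * (1 / 2 - real n) / real (Suc n)"
      by (simp only: nonzero_eq_divide_eq[OF of_nat_neq_0])
    then show ?thesis
      by (simp only: times_divide_eq_right)
  qed
  have "((1 / 2 :: real) gchoose Suc n) = ((1 / 2) gchoose n) * ((1 / 2 - real n) / real (Suc n))"
    by (rule *[OF gbinomial_mult_1])
  then have "\<bar>(1 / 2 :: real) gchoose Suc n\<bar> = \<bar>(1 / 2) gchoose n\<bar> * \<bar>(1 / 2 - real n) / real (Suc n)\<bar>"
    by (simp only: abs_mult)
  also have "\<dots> \<le> 1 * 1"
    by (intro mult_mono Suc.IH) (simp_all add: abs_le_iff field_simps)
  finally show ?case by (simp only: mult_1)
qed simp

lemma gevrey_bound_sqrt: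
  assumes "gevrey_bound s K I g r" "1 \<le> s" "0 < K" "r \<le> 1 / 2"
  shows "gevrey_bound s K I (\<lambda>x. sqrt (1 + g x) - 1) (2 * r)"
proof (rule gevrey_bound_small_series[OF assms, where a = "\<lambda>n. (1 / 2) gchoose Suc n" and m = "\<lambda>n. n"])
  fix x assume "x \<in> I"
  then have lt: "\<bar>g x\<bar> < 1"
    using abs_le_gevrey_bound[OF assms(1,3)] assms(4) by fastforce
  show "(\<lambda>n. ((1 / 2) gchoose Suc n) * g x ^ Suc n) sums (sqrt (1 + g x) - 1)"
    using sums_minus_constant_term[OF sqrt_series[OF lt]] by (simp only: gbinomial_0)
next
  fix n :: nat
  show "\<bar>(1 / 2 :: real) gchoose Suc n\<bar> \<le> 1"
    by (rule abs_half_gchoose_le_1)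
qed (rule order.refl)

lemma gevrey_bound_arctan:
  assumes "gevrey_bound s K I g r" "1 \<le> s" "0 < K" "r \<le> 1 / 2"
  shows "gevrey_bound s K I (\<lambda>x. arctan (g x)) (2 * r)"
proof (rule gevrey_bound_small_series[OF assms,
      where a = "\<lambda>k. (- 1) ^ k * (1 / real (k * 2 + 1))" and m = "\<lambda>k. k * 2"])
  fix x assume "x \<in> I"
  then have "\<bar>g x\<bar> \<le> 1"
    using abs_le_gevrey_bound[OF assms(1,3)] assms(4) by fastforce
  then have "(\<lambda>k. (- 1) ^ k * (1 / real (k * 2 + 1) * g x ^ (k * 2 + 1))) sums arctan (g x)"
    using summable_arctan_series arctan_series by (simp add: sums_iff)
  then show "(\<lambda>k. (- 1) ^ k * (1 / real (k * 2 + 1)) * g x ^ Suc (k * 2)) sums arctan (g x)"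
    by (simp only: mult.assoc Suc_eq_plus1)
next
  fix k :: nat
  show "\<bar>(- 1) ^ k * (1 / real (k * 2 + 1))\<bar> \<le> (1 :: real)"
    by (simp add: abs_mult power_abs)
qed simp

text \<open>
  A nonvanishing continuous function has constant sign on an interval.
\<close>
lemma gevrey_bound_abs:
  assumes "gevrey_bound s K I f A" "\<And>x. x \<in> I \<Longrightarrow> f x \<noteq> 0"
  shows "gevrey_bound s K I (\<lambda>x. \<bar>f x\<bar>) A"
proof -
  obtain d where d: "derivative_tower I f d"
    using assms(1) by (auto simp: gevrey_bound_def)
  have "continuous_on I (d 0)"
    using d unfolding derivative_tower_def by (intro DERIV_continuous_on) blast
  then have "continuous_on I f"
    using d by (simp add: derivative_tower_def cong: continuous_on_cong)
  then have "is_interval (f ` I)"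
    using interval connected_continuous_image by (simp add: is_interval_connected_1)
  moreover have "0 \<notin> f ` I"
    using assms(2) by auto
  ultimately have "(\<forall>x\<in>I. 0 < f x) \<or> (\<forall>x\<in>I. f x < 0)"
    unfolding is_interval_1 by (smt (verit, best) image_eqI)
  then show ?thesis
  proof
    assume "\<forall>x\<in>I. 0 < f x"
    then show ?thesis by (intro gevrey_bound_cong[OF assms(1)]) auto
  next
    assume "\<forall>x\<in>I. f x < 0"
    then show ?thesis
      by (intro gevrey_bound_cong[OF gevrey_bound_scale[OF assms(1), of "-1", simplified]]) auto
  qed
qed

end

section \<open>Norm and singular directions of a unimodular 2 by 2 matrix\<close>

lemma matrix_vector_mult_2:
  "(vector [vector [a, b], vector [c, d]] :: real^2^2) *v v
     = vector [a * v $ 1 + b * v $ 2, c * v $ 1 + d * v $ 2]"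
  unfolding vec_eq_iff forall_2 matrix_vector_mult_def by (simp add: sum_2)

lemma norm_vector_2_squared: "(norm (v :: real^2))\<^sup>2 = (v $ 1)\<^sup>2 + (v $ 2)\<^sup>2"
  unfolding power2_norm_eq_inner inner_vec_def by (simp add: sum_2 power2_eq_square)

text \<open>
  In terms of the doubled angle, the quadratic form of a matrix on the unit circle is a constant
  plus a first harmonic.
\<close>
lemma unit_circle_norm_squared:
  fixes a b c d t :: real
  shows "(norm ((vector [vector [a, b], vector [c, d]] :: real^2^2) *v vector [cos t, sin t]))\<^sup>2
    = (a\<^sup>2 + b\<^sup>2 + c\<^sup>2 + d\<^sup>2) / 2
      + (a\<^sup>2 + c\<^sup>2 - b\<^sup>2 - d\<^sup>2) / 2 * cos (2 * t) + (a * b + c * d) * sin (2 * t)"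
proof -
  have "(cos t)\<^sup>2 = 1 / 2 + cos (2 * t) / 2" "(sin t)\<^sup>2 = 1 / 2 - cos (2 * t) / 2"
    by (simp_all add: cos_double_cos sin_squared_eq diff_divide_distrib)
  moreover have "sin t * cos t = sin (2 * t) / 2"
    by (simp add: sin_double)
  moreover have "(norm ((vector [vector [a, b], vector [c, d]] :: real^2^2) *v vector [cos t, sin t]))\<^sup>2
     = (a\<^sup>2 + c\<^sup>2) * (cos t)\<^sup>2 + (b\<^sup>2 + d\<^sup>2) * (sin t)\<^sup>2 + 2 * (a * b + c * d) * (sin t * cos t)"
    unfolding norm_vector_2_squared
    by (simp add: matrix_vector_mult_2 power2_eq_square algebra_simps)
  ultimately show ?thesis
    by (simp only:) (simp add: field_simps)
qed

lemma harmonic_addition: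
  fixes X Y :: real
  obtains \<phi> where "\<And>t. X * cos t + Y * sin t = sqrt (X\<^sup>2 + Y\<^sup>2) * cos (t - \<phi>)"
proof -
  define r where "r = sqrt (X\<^sup>2 + Y\<^sup>2)"
  have "\<exists>\<phi>. X = r * cos \<phi> \<and> Y = r * sin \<phi>"
  proof (cases "X = 0 \<and> Y = 0")
    case False
    then have "0 < X\<^sup>2 + Y\<^sup>2"
      by (simp add: sum_power2_gt_zero_iff)
    then have "0 < r" and "(X / r)\<^sup>2 + (Y / r)\<^sup>2 = 1"
      using False by (simp_all add: r_def power_divide flip: add_divide_distrib)
    then obtain \<phi> where "X / r = cos \<phi>" "Y / r = sin \<phi>"
      using sincos_total_2pi by metis
    then have "X = r * cos \<phi> \<and> Y = r * sin \<phi>"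
      using \<open>0 < r\<close> by (simp add: divide_eq_eq mult.commute)
    then show ?thesis ..
  qed (simp add: r_def)
  then obtain \<phi> where "X = r * cos \<phi>" "Y = r * sin \<phi>"
    by blast
  then have "X * cos t + Y * sin t = r * cos (t - \<phi>)" for t
    by (simp add: cos_diff algebra_simps)
  then show ?thesis
    unfolding r_def by (rule that)
qed

lemma harmonic_addition_arctan:
  fixes X Y :: real
  assumes "0 < X"
  shows "X * cos t + Y * sin t = sqrt (X\<^sup>2 + Y\<^sup>2) * cos (t - arctan (Y / X))"
proof -
  have "sqrt (X\<^sup>2 + Y\<^sup>2) = sqrt (X\<^sup>2 * (1 + (Y / X)\<^sup>2))"
    using assms by (simp add: power_divide field_simps)
  then have "sqrt (X\<^sup>2 + Y\<^sup>2) = X * sqrt (1 + (Y / X)\<^sup>2)"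
    using assms by (simp add: real_sqrt_mult)
  moreover have "0 < sqrt (1 + (Y / X)\<^sup>2)"
    by (simp add: add_pos_nonneg)
  ultimately show ?thesis
    using assms by (simp add: cos_diff cos_arctan sin_arctan field_simps)
qed

text \<open>
  The letters \<open>H\<close>, \<open>X\<close>, \<open>Y\<close> are the mean and the two harmonic coefficients from
  \<open>unit_circle_norm_squared\<close>. For determinant \<open>1\<close> the amplitude of the harmonic is determined by the
  mean, and everything about \<open>A\<close> that is needed can be read off from these numbers.
\<close>
context
  fixes a b c d :: real and A :: "real^2^2" and H X Y :: real
  assumes A: "A = vector [vector [a, b], vector [c, d]]" and det: "a * d - b * c = 1"
    and H: "H = (a\<^sup>2 + b\<^sup>2 + c\<^sup>2 + d\<^sup>2) / 2"
    and X: "X = (a\<^sup>2 + c\<^sup>2 - b\<^sup>2 - d\<^sup>2) / 2" and Y: "Y = a * b + c * d"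
begin

lemma gram_identity: "X\<^sup>2 + Y\<^sup>2 = H\<^sup>2 - 1"
proof -
  have "H\<^sup>2 - (X\<^sup>2 + Y\<^sup>2) = (a * d - b * c)\<^sup>2"
    unfolding H X Y by (simp add: power2_eq_square field_simps)
  then show ?thesis using det by simp
qed

lemma one_le_mean_square: "1 \<le> H"
proof -
  have "0 \<le> (a - d)\<^sup>2 + (b + c)\<^sup>2" by simp
  also have "\<dots> = 2 * H - 2 * (a * d - b * c)"
    unfolding H by (simp add: power2_eq_square algebra_simps)
  finally show ?thesis using det by simp
qed

lemma opnorm_squared: "(opnorm A)\<^sup>2 = H + sqrt (H\<^sup>2 - 1)"
proof -
  define R where "R = H + sqrt (H\<^sup>2 - 1)"
  have "0 \<le> sqrt (H\<^sup>2 - 1)"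
    using one_le_mean_square by (simp add: one_le_power)
  then have R: "0 \<le> R"
    using one_le_mean_square by (simp add: R_def)
  obtain \<phi> where \<phi>: "\<And>t. X * cos t + Y * sin t = sqrt (X\<^sup>2 + Y\<^sup>2) * cos (t - \<phi>)"
    using harmonic_addition by blast
  have unit: "(norm (A *v vector [cos t, sin t]))\<^sup>2 = H + sqrt (H\<^sup>2 - 1) * cos (2 * t - \<phi>)" for t
    unfolding A unit_circle_norm_squared gram_identity[symmetric] \<phi>[symmetric] by (simp add: H X Y)
  have unit_le: "norm (A *v vector [cos t, sin t]) \<le> sqrt R" for t
  proof (rule real_le_rsqrt)
    show "(norm (A *v vector [cos t, sin t]))\<^sup>2 \<le> R"
      unfolding unit R_def using \<open>0 \<le> sqrt (H\<^sup>2 - 1)\<close> mult_left_mono[OF cos_le_one] by simp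
  qed
  have "norm (A *v v) \<le> sqrt R * norm v" for v :: "real^2"
  proof (cases "v = 0")
    case False
    then have "(v $ 1 / norm v)\<^sup>2 + (v $ 2 / norm v)\<^sup>2 = 1"
      unfolding power_divide add_divide_distrib[symmetric] norm_vector_2_squared[symmetric]
      by simp
    then obtain t where "v $ 1 / norm v = cos t" "v $ 2 / norm v = sin t"
      using sincos_total_2pi[of "v $ 1 / norm v" "v $ 2 / norm v"] by metis
    then have "v $ 1 = norm v * cos t" "v $ 2 = norm v * sin t"
      using False by (metis mult.commute nonzero_divide_eq_eq norm_eq_zero)+
    then have "v = norm v *\<^sub>R vector [cos t, sin t]"
      unfolding vec_eq_iff forall_2 by (simp only: vector_scaleR_component vector_2 real_scaleR_def)
    then have "A *v v = norm v *\<^sub>R (A *v vector [cos t, sin t])"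
      by (metis matrix_vector_mult_scaleR)
    then have "norm (A *v v) = norm v * norm (A *v vector [cos t, sin t])"
      by simp
    then show ?thesis
      using mult_left_mono[OF unit_le norm_ge_zero] by (simp add: mult.commute)
  qed simp
  then have "opnorm A \<le> sqrt R"
    unfolding opnorm_def by (rule onorm_le)
  moreover have "sqrt R \<le> opnorm A"
  proof -
    let ?u = "vector [cos (\<phi> / 2), sin (\<phi> / 2)] :: real^2"
    have "norm ?u = 1"
      using norm_vector_2_squared[of ?u] norm_ge_zero[of ?u] unfolding vector_2
      by (metis power2_eq_1_iff sin_cos_squared_add2 neg_0_le_iff_le not_one_le_zero)
    then have "norm (A *v ?u) \<le> opnorm A"
      using onorm[OF matrix_vector_mul_bounded_linear, of A ?u] by (simp add: opnorm_def)
    moreover have "(norm (A *v ?u))\<^sup>2 = R"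
      unfolding unit by (simp add: R_def)
    ultimately show ?thesis
      by (metis norm_ge_zero real_sqrt_unique)
  qed
  ultimately have "opnorm A = sqrt R"
    by (rule antisym)
  then show ?thesis
    using R by (simp only: R_def real_sqrt_pow2)
qed

lemma opnorm_nonneg: "0 \<le> opnorm A"
  unfolding opnorm_def by (rule onorm_pos_le[OF matrix_vector_mul_bounded_linear])

text \<open>
  This is \<open>opnorm_squared\<close> solved for the norm. Since \<open>2H\<close> is the sum of \<open>\<parallel>A\<parallel>\<^sup>2\<close> and its inverse,
  the two roots are \<open>\<parallel>A\<parallel> + 1/\<parallel>A\<parallel>\<close> and \<open>\<parallel>A\<parallel> - 1/\<parallel>A\<parallel>\<close>. The formula contains no nested root.
\<close>
lemma opnorm_eq: "opnorm A = (sqrt (2 * H + 2) + sqrt (2 * H - 2)) / 2"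
proof -
  have "sqrt (2 * H + 2) * sqrt (2 * H - 2) = 2 * sqrt (H\<^sup>2 - 1)"
  proof -
    have "(2 * H + 2) * (2 * H - 2) = 2\<^sup>2 * (H\<^sup>2 - 1)"
      by (simp add: power2_eq_square algebra_simps)
    then show ?thesis
      by (metis abs_numeral real_sqrt_abs real_sqrt_mult)
  qed
  moreover have "(sqrt (2 * H + 2))\<^sup>2 = 2 * H + 2" "(sqrt (2 * H - 2))\<^sup>2 = 2 * H - 2"
    using one_le_mean_square by simp_all
  ultimately have "((sqrt (2 * H + 2) + sqrt (2 * H - 2)) / 2)\<^sup>2 = (opnorm A)\<^sup>2"
    by (simp add: opnorm_squared power_divide power2_sum field_simps)
  moreover have "0 \<le> (sqrt (2 * H + 2) + sqrt (2 * H - 2)) / 2"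
    using one_le_mean_square by simp
  ultimately show ?thesis
    using opnorm_nonneg by (metis power2_eq_imp_eq)
qed

text \<open>
  The minimum \<open>H - sqrt(H\<^sup>2 - 1)\<close> of the squared length is the inverse of its maximum.
\<close>
lemma contracted_angle_iff:
  "contracted_angle A t \<longleftrightarrow> X * cos (2 * t) + Y * sin (2 * t) = - sqrt (X\<^sup>2 + Y\<^sup>2)"
proof -
  have "0 \<le> H\<^sup>2 - 1"
    using one_le_mean_square by (simp add: one_le_power)
  then have "(H + sqrt (H\<^sup>2 - 1)) * (H - sqrt (H\<^sup>2 - 1)) = 1"
    by (simp add: algebra_simps power2_eq_square)
  then have "(inverse (opnorm A))\<^sup>2 = H - sqrt (H\<^sup>2 - 1)"
    unfolding power_inverse opnorm_squared by (metis inverse_unique)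
  moreover have "contracted_angle A t \<longleftrightarrow>
      (norm (A *v vector [cos t, sin t]))\<^sup>2 = (inverse (opnorm A))\<^sup>2"
    unfolding contracted_angle_def using opnorm_nonneg by (simp add: power2_eq_iff_nonneg)
  moreover have "(norm (A *v vector [cos t, sin t]))\<^sup>2 = H + (X * cos (2 * t) + Y * sin (2 * t))"
    unfolding A unit_circle_norm_squared by (simp add: H X Y)
  ultimately have "contracted_angle A t \<longleftrightarrow>
      H + (X * cos (2 * t) + Y * sin (2 * t)) = H - sqrt (H\<^sup>2 - 1)"
    by (simp only:)
  then show ?thesis
    unfolding gram_identity by linarith
qed

text \<open>
  When \<open>X > 0\<close> the first basis vector is stretched more than the second one. Then the phase of the
  harmonic is \<open>arctan (Y / X)\<close>, the contracted direction lies within \<open>\<pi>/4\<close> of \<open>\<pi>/2\<close>, and no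
  representative other than this one falls into \<open>[0, \<pi>)\<close>.
\<close>
lemma s_angle_eq:
  assumes "0 < X"
  shows "s_angle A = pi / 2 + arctan (Y / X) / 2"
proof -
  have \<rho>: "0 < sqrt (X\<^sup>2 + Y\<^sup>2)"
    using assms by (simp add: add_pos_nonneg)
  have iff: "contracted_angle A t \<longleftrightarrow> cos (2 * t - arctan (Y / X)) = - 1" for t
    unfolding contracted_angle_iff harmonic_addition_arctan[OF assms]
    using \<rho> by (metis mult.right_neutral mult_cancel_left mult_minus_right order_less_irrefl)
  have bnd: "- (pi / 2) < arctan (Y / X)" "arctan (Y / X) < pi / 2"
    by (rule arctan_lbound arctan_ubound)+
  show ?thesis
    unfolding s_angle_def
  proof (rule the_equality)
    show "0 \<le> pi / 2 + arctan (Y / X) / 2 \<and> pi / 2 + arctan (Y / X) / 2 < pi \<and>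
        contracted_angle A (pi / 2 + arctan (Y / X) / 2)"
      using bnd by (simp add: iff)
  next
    fix t assume t: "0 \<le> t \<and> t < pi \<and> contracted_angle A t"
    then obtain n :: int where n: "2 * t - arctan (Y / X) = (2 * n + 1) * pi"
      by (auto simp: iff cos_eq_minus1)
    have "(-1) * pi < (2 * n + 1) * pi" "(2 * n + 1) * pi < 3 * pi"
      using n t bnd by (linarith)+
    then have "(-1 :: real) < 2 * n + 1" "2 * n + 1 < (3 :: real)"
      by (simp_all only: mult_less_cancel_right_pos[OF pi_gt_zero])
    then have "n = 0" by linarith
    then show "t = pi / 2 + arctan (Y / X) / 2"
      using n by simp
  qed
qed

end

lemma matrix_inv_2:
  fixes a b c d :: real
  assumes "a * d - b * c = 1"
  shows "matrix_inv (vector [vector [a, b], vector [c, d]] :: real^2^2)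
    = vector [vector [d, - b], vector [- c, a]]"
proof -
  let ?A = "vector [vector [a, b], vector [c, d]] :: real^2^2"
  let ?B = "vector [vector [d, - b], vector [- c, a]] :: real^2^2"
  have 1: "?A ** ?B = mat 1" and 2: "?B ** ?A = mat 1"
    using assms by (simp_all add: vec_eq_iff forall_2 matrix_matrix_mult_def sum_2 mat_def algebra_simps)
  show ?thesis
    unfolding matrix_inv_def
  proof (rule some_equality)
    fix B assume "?A ** B = mat 1 \<and> B ** ?A = mat 1"
    then have "B = (B ** ?A) ** ?B"
      unfolding matrix_mul_assoc[symmetric] 1 by (simp only: matrix_mul_rid)
    then show "B = ?B"
      using \<open>?A ** B = mat 1 \<and> B ** ?A = mat 1\<close> by (simp only: matrix_mul_lid)
  qed (use 1 2 in simp)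
qed

text \<open>
  The entries of the inverse matrix turn \<open>X\<close> and \<open>Y\<close> into the negatives of their analogues for the
  rows of \<open>A\<close>. The minimum of the harmonic becomes a maximum, so there is no shift by \<open>\<pi>/2\<close>.
\<close>
lemma u_angle_eq:
  fixes a b c d :: real
  assumes A: "A = vector [vector [a, b], vector [c, d]]" and det: "a * d - b * c = 1"
    and X: "X = (a\<^sup>2 + b\<^sup>2 - c\<^sup>2 - d\<^sup>2) / 2" and Y: "Y = a * c + b * d"
    and "0 < X"
  shows "u_angle A = arctan (Y / X) / 2"
proof -
  have \<rho>: "0 < sqrt (X\<^sup>2 + Y\<^sup>2)"
    using \<open>0 < X\<close> by (simp add: add_pos_nonneg)
  have "contracted_angle (matrix_inv A) t \<longleftrightarrow> X * cos (2 * t) + Y * sin (2 * t) = sqrt (X\<^sup>2 + Y\<^sup>2)" for t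
  proof -
    have "contracted_angle (matrix_inv A) t \<longleftrightarrow>
       (- X) * cos (2 * t) + (- Y) * sin (2 * t) = - sqrt ((- X)\<^sup>2 + (- Y)\<^sup>2)"
      using det by (intro contracted_angle_iff[OF matrix_inv_2[OF det, folded A], OF _ refl])
        (auto simp: X Y algebra_simps diff_divide_distrib add_divide_distrib)
    then show ?thesis by auto
  qed
  then have iff: "contracted_angle (matrix_inv A) t \<longleftrightarrow> cos (2 * t - arctan (Y / X)) = 1" for t
    unfolding harmonic_addition_arctan[OF \<open>0 < X\<close>] using \<rho> \<open>0 < X\<close> by simp
  have bnd: "- (pi / 2) < arctan (Y / X)" "arctan (Y / X) < pi / 2"
    by (rule arctan_lbound arctan_ubound)+
  show ?thesis
    unfolding u_angle_def
  proof (rule the_equality)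
    show "- pi / 2 < arctan (Y / X) / 2 \<and> arctan (Y / X) / 2 \<le> pi / 2 \<and>
        contracted_angle (matrix_inv A) (arctan (Y / X) / 2)"
      using bnd by (simp add: iff)
  next
    fix t assume t: "- pi / 2 < t \<and> t \<le> pi / 2 \<and> contracted_angle (matrix_inv A) t"
    then obtain n :: int where n: "2 * t - arctan (Y / X) = n * (2 * pi)"
      by (auto simp: iff cos_one_2pi_int)
    have "(-1) * (2 * pi) < n * (2 * pi)" "n * (2 * pi) < 1 * (2 * pi)"
      unfolding n[symmetric] using t bnd by linarith+
    then have "(-1 :: real) < n" "n < (1 :: real)"
      using pi_gt_zero by (simp_all only: mult_less_cancel_right_pos[of "2 * pi"] zero_less_mult_iff zero_less_numeral simp_thms)
    then have "n = 0" by linarith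
    then show "t = arctan (Y / X) / 2"
      using n by simp
  qed
qed

section \<open>The product of two diagonal matrices and a rotation\<close>

text \<open>
  The relative errors in the approximations of the norm by \<open>\<bar>cos \<theta>\<bar> e\<^sub>1 e\<^sub>2\<close> and of \<open>X\<close> by
  \<open>(cos \<theta> e\<^sub>1 e\<^sub>2)\<^sup>2/2\<close>. The arguments stand for \<open>\<tau> = tan \<theta>\<close>, \<open>\<sigma> = 1/cos \<theta>\<close> and \<open>y\<close>, \<open>z\<close> for the
  reciprocals of \<open>e\<^sub>1\<close>, \<open>e\<^sub>2\<close>, because these are the functions whose Gevrey norms are under control.
  Terms of size one have been cancelled by hand, since already the constant \<open>1\<close> has norm
  \<open>4\<pi>\<^sup>2/3\<close>, too large for the power series.
\<close>
definition norm_distortion :: "real \<Rightarrow> real \<Rightarrow> real \<Rightarrow> real \<Rightarrow> real" where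
  "norm_distortion \<tau> \<sigma> y z =
    1 / 2 * (sqrt (1 + ((\<tau>\<^sup>2 * (y ^ 4 + z ^ 4) + y ^ 4 * z ^ 4) + 2 * (\<sigma>\<^sup>2 * (y\<^sup>2 * z\<^sup>2)))) - 1)
    + 1 / 2 * (sqrt (1 + ((\<tau>\<^sup>2 * (y ^ 4 + z ^ 4) + y ^ 4 * z ^ 4) - 2 * (\<sigma>\<^sup>2 * (y\<^sup>2 * z\<^sup>2)))) - 1)"

definition gap_distortion :: "real \<Rightarrow> real \<Rightarrow> real \<Rightarrow> real" where
  "gap_distortion \<tau> y z = \<tau>\<^sup>2 * z ^ 4 - y ^ 4 * (\<tau>\<^sup>2 + z ^ 4)"

definition double_angle_tangent :: "real \<Rightarrow> real \<Rightarrow> real \<Rightarrow> real" where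
  "double_angle_tangent \<tau> y z = 2 * (\<tau> * y\<^sup>2 * ((1 - z ^ 4) * (1 / (1 + gap_distortion \<tau> y z))))"

lemma cancel_gap:
  fixes A b c D :: real
  assumes "A \<noteq> 0" "D \<noteq> 0"
  shows "A * (b * c) / (A / 2 * D) = 2 * (b * (c * (1 / D)))"
  using assms by (simp add: field_simps)

lemma diag_rot_diag_entries:
  "diag2 q (1 / q) ** rot2 t ** diag2 p (1 / p) =
    vector [vector [q * cos t * p, - (q * sin t / p)], vector [sin t * p / q, cos t / (q * p)]]"
  unfolding diag2_def rot2_def
  by (simp add: vec_eq_iff forall_2 matrix_matrix_mult_def sum_2)

context
  fixes p q t :: real
  assumes p: "0 < p" and q: "0 < q" and cos: "cos t \<noteq> 0"
begin

private abbreviation (input) "E \<equiv> diag2 q (1 / q) ** rot2 t ** diag2 p (1 / p)"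

lemma diag_rot_diag_det:
  "(q * cos t * p) * (cos t / (q * p)) - (- (q * sin t / p)) * (sin t * p / q) = 1"
  using p q by (simp add: power2_eq_square[symmetric] field_simps)

text \<open>
  Both \<open>2H + 2\<close> and \<open>2H - 2\<close> are \<open>(cos t \<cdot> p q)\<^sup>2\<close> times a quantity close to \<open>1\<close>; the number \<open>2\<close>
  itself becomes the term \<open>2 \<sigma>\<^sup>2 y\<^sup>2 z\<^sup>2\<close>.
\<close>
lemma opnorm_diag_rot_diag:
  "opnorm E = \<bar>cos t\<bar> * p * q * (1 + norm_distortion (tan t) (1 / cos t) (1 / p) (1 / q))"
proof -
  let ?g = "(tan t)\<^sup>2 * ((1 / p) ^ 4 + (1 / q) ^ 4) + (1 / p) ^ 4 * (1 / q) ^ 4"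
  let ?d = "2 * ((1 / cos t)\<^sup>2 * ((1 / p)\<^sup>2 * (1 / q)\<^sup>2))"
  define H where "H = ((q * cos t * p)\<^sup>2 + (- (q * sin t / p))\<^sup>2 + (sin t * p / q)\<^sup>2 + (cos t / (q * p))\<^sup>2) / 2"
  have "2 * H = (cos t * p * q)\<^sup>2 * (1 + ?g)"
    using p q cos by (simp add: H_def tan_def field_simps power2_eq_square power4_eq_xxxx)
  moreover have "2 = (cos t * p * q)\<^sup>2 * ?d"
    using p q cos by (simp add: field_simps)
  ultimately have "2 * H + 2 = (cos t * p * q)\<^sup>2 * (1 + (?g + ?d))"
    "2 * H - 2 = (cos t * p * q)\<^sup>2 * (1 + (?g - ?d))"
    by (simp_all only: distrib_left right_diff_distrib add.assoc add_diff_eq)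
  moreover define u v where "u = sqrt (1 + (?g + ?d))" and "v = sqrt (1 + (?g - ?d))"
  ultimately have "sqrt (2 * H + 2) = \<bar>cos t\<bar> * p * q * u" "sqrt (2 * H - 2) = \<bar>cos t\<bar> * p * q * v"
    using p q by (simp_all only: u_def v_def real_sqrt_mult real_sqrt_abs abs_mult abs_of_pos)
  then have "(sqrt (2 * H + 2) + sqrt (2 * H - 2)) / 2 = \<bar>cos t\<bar> * p * q * ((u + v) / 2)"
    by (simp add: distrib_left)
  also have "(u + v) / 2 = 1 + norm_distortion (tan t) (1 / cos t) (1 / p) (1 / q)"
    unfolding norm_distortion_def u_def[symmetric] v_def[symmetric] by (simp add: field_simps)
  finally show ?thesis
    unfolding opnorm_eq[OF diag_rot_diag_entries diag_rot_diag_det H_def refl refl] .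
qed

lemma s_angle_diag_rot_diag:
  assumes gap: "0 < 1 + gap_distortion (tan t) (1 / p) (1 / q)"
  shows "pi / 2 - s_angle E = arctan (double_angle_tangent (tan t) (1 / p) (1 / q)) / 2"
proof -
  define X where "X = ((q * cos t * p)\<^sup>2 + (sin t * p / q)\<^sup>2 - (- (q * sin t / p))\<^sup>2 - (cos t / (q * p))\<^sup>2) / 2"
  define Y where "Y = (q * cos t * p) * (- (q * sin t / p)) + (sin t * p / q) * (cos t / (q * p))"
  let ?w = "double_angle_tangent (tan t) (1 / p) (1 / q)"
  let ?D = "1 + gap_distortion (tan t) (1 / p) (1 / q)"
  have X: "X = (cos t * p * q)\<^sup>2 / 2 * ?D"
    using p q cos by (simp add: X_def gap_distortion_def tan_def field_simps power2_eq_square power4_eq_xxxx)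
  have "Y = - ((cos t * p * q)\<^sup>2 * (tan t * (1 / p)\<^sup>2 * (1 - (1 / q) ^ 4)))"
    using p q cos by (simp add: Y_def tan_def field_simps power2_eq_square power4_eq_xxxx)
  moreover have A: "(cos t * p * q)\<^sup>2 \<noteq> 0" and D: "?D \<noteq> 0"
    using p q cos gap by simp_all
  ultimately have "Y / X = - ?w"
    unfolding X double_angle_tangent_def by (simp only: minus_divide_left[symmetric] cancel_gap[OF A D])
  moreover have "0 < X"
    unfolding X using p q cos gap by simp
  ultimately have "s_angle E = pi / 2 + arctan (- ?w) / 2"
    using s_angle_eq[OF diag_rot_diag_entries diag_rot_diag_det refl X_def Y_def] by simp
  then show ?thesis
    by (simp add: arctan_minus)
qed

lemma u_angle_diag_rot_diag:
  assumes gap: "0 < 1 + gap_distortion (tan t) (1 / q) (1 / p)"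
  shows "u_angle E = arctan (double_angle_tangent (tan t) (1 / q) (1 / p)) / 2"
proof -
  define X where "X = ((q * cos t * p)\<^sup>2 + (- (q * sin t / p))\<^sup>2 - (sin t * p / q)\<^sup>2 - (cos t / (q * p))\<^sup>2) / 2"
  define Y where "Y = (q * cos t * p) * (sin t * p / q) + (- (q * sin t / p)) * (cos t / (q * p))"
  let ?w = "double_angle_tangent (tan t) (1 / q) (1 / p)"
  let ?D = "1 + gap_distortion (tan t) (1 / q) (1 / p)"
  have X: "X = (cos t * p * q)\<^sup>2 / 2 * ?D"
    using p q cos by (simp add: X_def gap_distortion_def tan_def field_simps power2_eq_square power4_eq_xxxx)
  have "Y = (cos t * p * q)\<^sup>2 * (tan t * (1 / q)\<^sup>2 * (1 - (1 / p) ^ 4))"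
    using p q cos by (simp add: Y_def tan_def field_simps power2_eq_square power4_eq_xxxx)
  moreover have A: "(cos t * p * q)\<^sup>2 \<noteq> 0" and D: "?D \<noteq> 0"
    using p q cos gap by simp_all
  ultimately have "Y / X = ?w"
    unfolding X double_angle_tangent_def by (simp only: minus_divide_left[symmetric] cancel_gap[OF A D])
  moreover have "0 < X"
    unfolding X using p q cos gap by simp
  ultimately show ?thesis
    using u_angle_eq[OF diag_rot_diag_entries diag_rot_diag_det X_def Y_def] by simp
qed

end

section \<open>Gevrey bounds for the distortions\<close>

text \<open>
  The number \<open>2000\<close> is chosen for the last step of \<open>gevrey_bound_double_angle\<close>, where it has to
  exceed \<open>2 \<cdot> 23\<^sup>2\<close>.
\<close>
lemma small_parameter_consequences:
  fixes T \<epsilon> :: real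
  assumes T: "1 \<le> T" and \<epsilon>: "0 \<le> \<epsilon>" and small: "T\<^sup>2 * \<epsilon> \<le> 1 / 2000"
  shows "\<epsilon> \<le> 1 / 2000" "T * \<epsilon> \<le> 1 / 2000" "T\<^sup>2 * \<epsilon> ^ 4 \<le> 1 / 2000"
    "\<epsilon> ^ 4 \<le> 1 / 2000" "\<epsilon> ^ 4 * \<epsilon> ^ 4 \<le> 1 / 2000"
proof -
  have "T * \<epsilon> \<le> T * (T * \<epsilon>)"
    using mult_right_mono[OF T, of "T * \<epsilon>"] T \<epsilon> by simp
  then show T\<epsilon>: "T * \<epsilon> \<le> 1 / 2000"
    using small by (simp add: power2_eq_square mult.assoc)
  then show \<epsilon>_le: "\<epsilon> \<le> 1 / 2000"
    using mult_right_mono[OF T \<epsilon>] by simp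
  have "\<epsilon> ^ 3 \<le> 1"
    using \<epsilon> \<epsilon>_le by (intro power_le_one) auto
  then have "(T\<^sup>2 * \<epsilon>) * \<epsilon> ^ 3 \<le> (1 / 2000) * 1"
    using small \<epsilon> by (intro mult_mono) auto
  then show "T\<^sup>2 * \<epsilon> ^ 4 \<le> 1 / 2000"
    by (simp add: power4_eq_xxxx power3_eq_cube mult.assoc)
  have "\<epsilon> ^ 4 \<le> \<epsilon> ^ 1"
    using \<epsilon> \<epsilon>_le by (intro power_decreasing) auto
  then show *: "\<epsilon> ^ 4 \<le> 1 / 2000"
    using \<epsilon>_le by simp
  have "\<epsilon> ^ 4 * \<epsilon> ^ 4 \<le> (1 / 2000) * 1"
    using * by (intro mult_mono) auto
  then show "\<epsilon> ^ 4 * \<epsilon> ^ 4 \<le> 1 / 2000" by simp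
qed

context nondegenerate_interval
begin

context
  fixes s K T \<epsilon> :: real and \<tau> y z :: "real \<Rightarrow> real"
  assumes s: "1 \<le> s" and K: "0 < K" and \<tau>: "gevrey_bound s K I \<tau> T" and y: "gevrey_bound s K I y \<epsilon>" and z: "gevrey_bound s K I z \<epsilon>"
    and T: "1 \<le> T" and small: "T\<^sup>2 * \<epsilon> \<le> 1 / 2000"
begin

private lemmas gevrey_mult = gevrey_bound_mult[OF _ _ s K]
  and gevrey_power = gevrey_bound_power[OF _ s K]
  and small_consequences = small_parameter_consequences[OF T gevrey_bound_nonneg[OF K y] small]

lemma gevrey_bound_norm_distortion:
  assumes \<sigma>: "gevrey_bound s K I \<sigma> T"
  shows "gevrey_bound s K I (\<lambda>x. norm_distortion (\<tau> x) (\<sigma> x) (y x) (z x)) (1 / 100)"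
proof -
  have y4: "gevrey_bound s K I (\<lambda>x. y x ^ 4) (\<epsilon> ^ 4)" and z4: "gevrey_bound s K I (\<lambda>x. z x ^ 4) (\<epsilon> ^ 4)"
    using y z by (auto intro: gevrey_power)
  note g = gevrey_bound_add[OF gevrey_mult[OF gevrey_power[OF \<tau>, of 2] gevrey_bound_add[OF y4 z4]] gevrey_mult[OF y4 z4]]
  note d = gevrey_bound_scale[OF gevrey_mult[OF gevrey_power[OF \<sigma>, of 2]
    gevrey_mult[OF gevrey_power[OF y, of 2] gevrey_power[OF z, of 2]]], of 2]
  have r: "(T\<^sup>2 * (\<epsilon> ^ 4 + \<epsilon> ^ 4) + \<epsilon> ^ 4 * \<epsilon> ^ 4) + \<bar>2\<bar> * (T\<^sup>2 * (\<epsilon>\<^sup>2 * \<epsilon>\<^sup>2)) \<le> 1 / 200"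
  proof -
    have "\<epsilon>\<^sup>2 * \<epsilon>\<^sup>2 = \<epsilon> ^ 4" by (simp flip: power_add)
    then show ?thesis
      using small_consequences(3) small_consequences(4,5) by (simp add: distrib_left)
  qed
  note plus = gevrey_bound_mono[OF gevrey_bound_add[OF g d] r K, simplified]
  note minus = gevrey_bound_mono[OF gevrey_bound_diff[OF g d] r K, simplified]
  show ?thesis
    unfolding norm_distortion_def
    using gevrey_bound_add[OF
        gevrey_bound_scale[OF gevrey_bound_sqrt[OF plus s K], of "1 / 2"]
        gevrey_bound_scale[OF gevrey_bound_sqrt[OF minus s K], of "1 / 2"]]
    by simp
qed

lemma gevrey_bound_gap_distortion: "gevrey_bound s K I (\<lambda>x. gap_distortion (\<tau> x) (y x) (z x)) (1 / 500)"
proof -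
  have y4: "gevrey_bound s K I (\<lambda>x. y x ^ 4) (\<epsilon> ^ 4)" and z4: "gevrey_bound s K I (\<lambda>x. z x ^ 4) (\<epsilon> ^ 4)"
    using y z by (auto intro: gevrey_power)
  have "T\<^sup>2 * \<epsilon> ^ 4 + \<epsilon> ^ 4 * (T\<^sup>2 + \<epsilon> ^ 4) \<le> 1 / 500"
    using small_consequences(3) small_consequences(4,5) by (simp add: distrib_left mult.commute)
  from gevrey_bound_mono[OF gevrey_bound_diff[OF gevrey_mult[OF gevrey_power[OF \<tau>, of 2] z4]
    gevrey_mult[OF y4 gevrey_bound_add[OF gevrey_power[OF \<tau>, of 2] z4]]] this K]
  show ?thesis
    by (simp add: gap_distortion_def)
qed

text \<open>
  The leading term \<open>2 \<tau> y\<^sup>2\<close> has norm of order \<open>T b\<^sup>2\<close>, which \<open>T \<epsilon> \<le> 1/2000\<close> turns into a small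
  multiple of \<open>b\<close>. The bound \<open>b\<close> is kept apart from \<open>\<epsilon>\<close>, as the estimate has to be in terms of the
  actual norm of \<open>y\<close>.
\<close>
lemma gevrey_bound_double_angle:
  assumes b: "gevrey_bound s K I y b" "b \<le> \<epsilon>"
  shows "gevrey_bound s K I (\<lambda>x. arctan (double_angle_tangent (\<tau> x) (y x) (z x)) / 2) b"
proof -
  have b0: "0 \<le> b"
    using gevrey_bound_nonneg[OF K b(1)] .
  have one: "gevrey_bound s K I (\<lambda>x. 1) 22"
    using gevrey_const_le by (intro gevrey_bound_const[OF K]) simp
  have inv: "gevrey_bound s K I (\<lambda>x. 1 / (1 + gap_distortion (\<tau> x) (y x) (z x))) 23"
    using gevrey_bound_mono[OF gevrey_bound_add[OF gevrey_bound_inverse[OF gevrey_bound_gap_distortion s K] one], of 23] K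
    by simp
  have z4: "gevrey_bound s K I (\<lambda>x. 1 - z x ^ 4) 23"
    using gevrey_bound_mono[OF gevrey_bound_diff[OF one gevrey_power[OF z, of 4]], of 23] K small_consequences(4,5) by simp
  have "T * b\<^sup>2 \<le> b / 2000"
  proof -
    have "T * b \<le> 1 / 2000"
      using small_consequences(2) mult_left_mono[OF b(2), of T] T by linarith
    then have "(T * b) * b \<le> (1 / 2000) * b"
      using b0 by (rule mult_right_mono)
    then show ?thesis by (simp add: power2_eq_square mult.assoc)
  qed
  then have "\<bar>2\<bar> * (T * b\<^sup>2 * (23 * 23)) \<le> b"
    using b0 by simp
  from gevrey_bound_mono[OF gevrey_bound_scale[OF gevrey_mult[OF gevrey_mult[OF \<tau> gevrey_power[OF b(1), of 2]]
      gevrey_mult[OF z4 inv]], of 2] this K]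
  have "gevrey_bound s K I (\<lambda>x. double_angle_tangent (\<tau> x) (y x) (z x)) b"
    by (simp add: double_angle_tangent_def)
  from gevrey_bound_scale[OF gevrey_bound_arctan[OF this s K], of "1 / 2"]
  show ?thesis
    using b(2) small_consequences(1) by simp
qed

end

end

text \<open>
  All conclusions of the theorem, with the dynamical input reduced to the single inequality
  \<open>(C Q)\<^sup>2 \<epsilon> \<le> 1/2000\<close>. The bounds hold for \<open>K\<close> itself, hence for every \<open>K' \<ge> K\<close>. The requirement
  \<open>C \<ge> 23\<close> leaves room for the norm \<open>4\<pi>\<^sup>2/3 \<le> 22\<close> of the constant \<open>1\<close> in \<open>1 + \<Sigma>\<close>.
\<close>
lemma (in nondegenerate_interval) product_estimates:
  fixes s K C Q \<epsilon> K' :: real and e1 e2 \<theta> :: "real \<Rightarrow> real"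
  defines "E \<equiv> (\<lambda>x. diag2 (e2 x) (1 / e2 x) ** rot2 (\<theta> x) ** diag2 (e1 x) (1 / e1 x))"
  assumes s: "1 \<le> s" and K: "0 < K" "K \<le> K'" and C: "23 \<le> C" and Q: "1 \<le> Q"
    and small: "(C * Q)\<^sup>2 * \<epsilon> \<le> 1 / 2000"
    and e1: "e1 \<in> gevrey s K I" and e2: "e2 \<in> gevrey s K I" and \<theta>: "\<theta> \<in> gevrey s K I"
    and pos: "\<And>x. x \<in> I \<Longrightarrow> 0 < e1 x" "\<And>x. x \<in> I \<Longrightarrow> 0 < e2 x"
    and cos: "\<And>x. x \<in> I \<Longrightarrow> cos (\<theta> x) \<noteq> 0"
    and sec_le: "gevrey_norm s K I (\<lambda>x. 1 / cos (\<theta> x)) \<le> ennreal (C * Q)"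
    and tan_le: "gevrey_norm s K I (\<lambda>x. tan (\<theta> x)) \<le> ennreal (C * Q)"
    and cos_le: "gevrey_norm s K I (\<lambda>x. cos (\<theta> x)) \<le> ennreal C"
    and inv_e1_le: "gevrey_norm s K I (\<lambda>x. 1 / e1 x) \<le> ennreal \<epsilon>"
    and inv_e2_le: "gevrey_norm s K I (\<lambda>x. 1 / e2 x) \<le> ennreal \<epsilon>"
    and \<epsilon>: "0 \<le> \<epsilon>"
  shows "(INF x\<in>I. opnorm (E x)) \<ge> 1 / (2 * C) * (INF x\<in>I. e1 x) * (INF x\<in>I. e2 x) / Q"
    and "(\<lambda>x. opnorm (E x)) \<in> gevrey s K' I"
    and "gevrey_norm s K' I (\<lambda>x. opnorm (E x))
      \<le> ennreal (C\<^sup>2) * gevrey_norm s K I e1 * gevrey_norm s K I e2"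
    and "(\<lambda>x. 1 / opnorm (E x)) \<in> gevrey s K' I"
    and "gevrey_norm s K' I (\<lambda>x. 1 / opnorm (E x)) \<le> ennreal (C\<^sup>2) *
      gevrey_norm s K I (\<lambda>x. 1 / e1 x) * gevrey_norm s K I (\<lambda>x. 1 / e2 x) * ennreal Q"
    and "\<forall>x\<in>I. 1 < opnorm (E x)"
    and "(\<lambda>x. pi / 2 - s_angle (E x)) \<in> gevrey s K' I"
    and "gevrey_norm s K' I (\<lambda>x. pi / 2 - s_angle (E x))
      \<le> gevrey_norm s K I (\<lambda>x. 1 / e1 x) ^ 3 * gevrey_norm s K I e1 ^ 2"
    and "(\<lambda>x. u_angle (E x)) \<in> gevrey s K' I"
    and "gevrey_norm s K' I (\<lambda>x. u_angle (E x))
      \<le> gevrey_norm s K I (\<lambda>x. 1 / e2 x) ^ 3 * gevrey_norm s K I e2 ^ 2"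
proof -
  let ?bnd = "gevrey_bound s K I"
  define T where "T = C * Q"
  have CQ: "C \<le> T"
    using mult_left_mono[OF Q, of C] C by (simp add: T_def)
  then have T: "1 \<le> T"
    using C by simp
  have T2: "T\<^sup>2 * \<epsilon> \<le> 1 / 2000"
    using small by (simp add: T_def)
  \<comment> \<open>A finite norm alone does not make a function smooth, so the reciprocals and trigonometric
    functions need the closure properties of smoothness before their bounds can be used.\<close>
  have mem: "f \<in> gevrey s K I" if "smooth_on I f" "gevrey_norm s K I f \<le> ennreal B" for f B
    using that ennreal_less_top order.strict_trans1 by (fastforce simp: gevrey_def)
  have smooth: "smooth_on I e1" "smooth_on I e2" "smooth_on I \<theta>"
    using e1 e2 \<theta> by (simp_all add: gevrey_def)
  have sec: "?bnd (\<lambda>x. 1 / cos (\<theta> x)) T"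
    using mem[OF smooth_on_inverse[OF smooth_on_cos[OF smooth(3)] cos] sec_le] sec_le T K
    by (simp add: gevrey_bound_iff T_def)
  have tan: "?bnd (\<lambda>x. tan (\<theta> x)) T"
    using mem[OF smooth_on_tan[OF smooth(3) cos] tan_le] tan_le T K
    by (simp add: gevrey_bound_iff T_def)
  have cos_bnd: "?bnd (\<lambda>x. cos (\<theta> x)) C"
    using mem[OF smooth_on_cos[OF smooth(3)] cos_le] cos_le C K by (simp add: gevrey_bound_iff)
  have inv1: "(\<lambda>x. 1 / e1 x) \<in> gevrey s K I" and inv2: "(\<lambda>x. 1 / e2 x) \<in> gevrey s K I"
    using mem[OF smooth_on_inverse[OF smooth(1)] inv_e1_le] mem[OF smooth_on_inverse[OF smooth(2)] inv_e2_le] pos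
    by force+
  define a1 a2 b1 b2 where "a1 = enn2real (gevrey_norm s K I e1)" and "a2 = enn2real (gevrey_norm s K I e2)"
    and "b1 = enn2real (gevrey_norm s K I (\<lambda>x. 1 / e1 x))"
    and "b2 = enn2real (gevrey_norm s K I (\<lambda>x. 1 / e2 x))"
  have norms: "gevrey_norm s K I e1 = ennreal a1" "gevrey_norm s K I e2 = ennreal a2"
      "gevrey_norm s K I (\<lambda>x. 1 / e1 x) = ennreal b1" "gevrey_norm s K I (\<lambda>x. 1 / e2 x) = ennreal b2"
    using e1 e2 inv1 inv2 by (simp_all add: gevrey_def a1_def a2_def b1_def b2_def)
  have a1: "?bnd e1 a1" and a2: "?bnd e2 a2" and b1: "?bnd (\<lambda>x. 1 / e1 x) b1" and b2: "?bnd (\<lambda>x. 1 / e2 x) b2"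
    unfolding a1_def a2_def b1_def b2_def using gevrey_bound_enn2real K e1 e2 inv1 inv2 by blast+
  have nonneg: "0 \<le> a1" "0 \<le> a2" "0 \<le> b1" "0 \<le> b2"
    by (simp_all add: a1_def a2_def b1_def b2_def)
  have b_le: "b1 \<le> \<epsilon>" "b2 \<le> \<epsilon>"
    using inv_e1_le inv_e2_le \<epsilon> by (simp_all add: norms)
  have y: "?bnd (\<lambda>x. 1 / e1 x) \<epsilon>" and z: "?bnd (\<lambda>x. 1 / e2 x) \<epsilon>"
    using gevrey_bound_mono[OF b1 b_le(1)] gevrey_bound_mono[OF b2 b_le(2)] K by simp_all
  have \<epsilon>_le: "\<epsilon> \<le> 1 / 2000"
    by (rule small_parameter_consequences(1)[OF T \<epsilon> T2])
  define \<Sigma> where "\<Sigma> x = norm_distortion (tan (\<theta> x)) (1 / cos (\<theta> x)) (1 / e1 x) (1 / e2 x)" for x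
  have \<Sigma>: "?bnd \<Sigma> (1 / 100)"
    unfolding \<Sigma>_def by (rule gevrey_bound_norm_distortion[OF s K(1) tan y z T T2 sec])
  note abs_le = abs_le_gevrey_bound[OF _ K(1)]
  have one: "?bnd (\<lambda>x. 1) 22"
    using gevrey_const_le K by (intro gevrey_bound_const) simp_all
  have opnorm: "opnorm (E x) = \<bar>cos (\<theta> x)\<bar> * e1 x * e2 x * (1 + \<Sigma> x)" if "x \<in> I" for x
    unfolding E_def \<Sigma>_def by (rule opnorm_diag_rot_diag[OF pos[OF that] cos[OF that]])
  have lower: "1 / (2 * T) * (e1 x * e2 x) \<le> opnorm (E x)" if x: "x \<in> I" for x
  proof -
    have "1 / \<bar>cos (\<theta> x)\<bar> \<le> T"
      using abs_le[OF sec x] by simp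
    then have "1 / T \<le> \<bar>cos (\<theta> x)\<bar>"
      using T cos[OF x] by (simp add: field_simps)
    moreover have "1 / 2 \<le> 1 + \<Sigma> x"
      using abs_le[OF \<Sigma> x] by linarith
    ultimately have "1 / T * (1 / 2) \<le> \<bar>cos (\<theta> x)\<bar> * (1 + \<Sigma> x)"
      using T by (intro mult_mono) auto
    then have "1 / T * (1 / 2) * (e1 x * e2 x) \<le> \<bar>cos (\<theta> x)\<bar> * (1 + \<Sigma> x) * (e1 x * e2 x)"
      using pos[OF x] by (intro mult_right_mono) auto
    then show ?thesis
      by (simp add: opnorm[OF x] ac_simps)
  qed
  show "(INF x\<in>I. opnorm (E x)) \<ge> 1 / (2 * C) * (INF x\<in>I. e1 x) * (INF x\<in>I. e2 x) / Q"
  proof (rule cINF_greatest[OF nonempty])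
    fix x assume x: "x \<in> I"
    have "bdd_below (e1 ` I)" "bdd_below (e2 ` I)"
      using pos by (auto intro!: bdd_belowI[of _ 0] less_imp_le)
    then have "(INF x\<in>I. e1 x) \<le> e1 x" "(INF x\<in>I. e2 x) \<le> e2 x"
      using x by (auto intro: cINF_lower)
    moreover have "0 \<le> (INF x\<in>I. e1 x)" "0 \<le> (INF x\<in>I. e2 x)"
      by (rule cINF_greatest[OF nonempty], rule less_imp_le, erule pos)+
    ultimately have "(INF x\<in>I. e1 x) * (INF x\<in>I. e2 x) \<le> e1 x * e2 x"
      by (intro mult_mono) auto
    then have "1 / (2 * T) * ((INF x\<in>I. e1 x) * (INF x\<in>I. e2 x)) \<le> 1 / (2 * T) * (e1 x * e2 x)"
      using T by (intro mult_left_mono) auto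
    then show "1 / (2 * C) * (INF x\<in>I. e1 x) * (INF x\<in>I. e2 x) / Q \<le> opnorm (E x)"
      using lower[OF x] by (simp add: T_def)
  qed
  show gt_1: "\<forall>x\<in>I. 1 < opnorm (E x)"
  proof
    fix x assume x: "x \<in> I"
    have T\<epsilon>: "T * \<epsilon> \<le> 1 / 2000"
      by (rule small_parameter_consequences(2)[OF T \<epsilon> T2])
    have "1 \<le> \<epsilon> * e1 x" "1 \<le> \<epsilon> * e2 x"
      using abs_le[OF y x] abs_le[OF z x] pos[OF x] by (simp_all add: field_simps)
    then have "1 * 1 \<le> (\<epsilon> * e1 x) * (\<epsilon> * e2 x)"
      using pos[OF x] \<epsilon> by (intro mult_mono) auto
    also have "\<dots> \<le> (1 / 2000 * e1 x) * (\<epsilon> * e2 x)"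
      using pos[OF x] \<epsilon> \<epsilon>_le by (intro mult_right_mono) auto
    finally have "T * 1 \<le> T * ((1 / 2000 * e1 x) * (\<epsilon> * e2 x))"
      using T by (intro mult_left_mono) auto
    also have "\<dots> = (T * \<epsilon>) * (1 / 2000 * (e1 x * e2 x))"
      by simp
    also have "\<dots> \<le> (1 / 2000) * (1 / 2000 * (e1 x * e2 x))"
      using T\<epsilon> pos[OF x] by (intro mult_right_mono) auto
    finally have "2 * T < e1 x * e2 x"
      using T by linarith
    then have "1 < 1 / (2 * T) * (e1 x * e2 x)"
      using T by (simp add: less_divide_eq)
    also have "\<dots> \<le> opnorm (E x)"
      by (rule lower[OF x])
    finally show "1 < opnorm (E x)" .
  qed
  have result: "f \<in> gevrey s K' I \<and> gevrey_norm s K' I f \<le> ennreal B" if "?bnd f B" for f B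
    using gevrey_bound_increase_K[OF that K gevrey_bound_nonneg[OF K(1) that]] K
      gevrey_bound_nonneg[OF K(1) that] by (simp add: gevrey_bound_iff)
  have "?bnd (\<lambda>x. \<bar>cos (\<theta> x)\<bar> * e1 x * e2 x * (1 + \<Sigma> x)) (C * a1 * a2 * (22 + 1 / 100))"
    using gevrey_bound_abs[OF cos_bnd cos] one \<Sigma> a1 a2 s K
    by (intro gevrey_bound_mult gevrey_bound_add) auto
  then have "?bnd (\<lambda>x. opnorm (E x)) (C * a1 * a2 * (22 + 1 / 100))"
    by (rule gevrey_bound_cong) (simp add: opnorm)
  moreover have "C * a1 * a2 * (22 + 1 / 100) \<le> C\<^sup>2 * a1 * a2"
  proof -
    have "C * a1 * a2 * (22 + 1 / 100) \<le> C * a1 * a2 * C"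
      using C nonneg by (intro mult_left_mono) auto
    then show ?thesis by (simp add: power2_eq_square ac_simps)
  qed
  ultimately have "?bnd (\<lambda>x. opnorm (E x)) (C\<^sup>2 * a1 * a2)"
    using gevrey_bound_mono K by blast
  from result[OF this] show "(\<lambda>x. opnorm (E x)) \<in> gevrey s K' I"
    "gevrey_norm s K' I (\<lambda>x. opnorm (E x)) \<le> ennreal (C\<^sup>2) * gevrey_norm s K I e1 * gevrey_norm s K I e2"
    using nonneg by (simp_all add: norms ennreal_mult)
  have "?bnd (\<lambda>x. 1 / (1 + \<Sigma> x)) 23"
    using gevrey_bound_mono[OF gevrey_bound_add[OF gevrey_bound_inverse[OF \<Sigma> s K(1)] one] _ K(1), of 23]
    by simp
  then have "?bnd (\<lambda>x. \<bar>1 / cos (\<theta> x)\<bar> * (1 / e1 x) * (1 / e2 x) * (1 / (1 + \<Sigma> x))) (T * b1 * b2 * 23)"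
    using gevrey_bound_abs[OF sec] cos b1 b2 s K by (intro gevrey_bound_mult) auto
  then have "?bnd (\<lambda>x. 1 / opnorm (E x)) (T * b1 * b2 * 23)"
    by (rule gevrey_bound_cong) (simp add: opnorm)
  moreover have "T * b1 * b2 * 23 \<le> C\<^sup>2 * b1 * b2 * Q"
  proof -
    have "T * b1 * b2 * 23 \<le> T * b1 * b2 * C"
      using C T nonneg by (intro mult_left_mono) auto
    then show ?thesis by (simp add: T_def power2_eq_square ac_simps)
  qed
  ultimately have "?bnd (\<lambda>x. 1 / opnorm (E x)) (C\<^sup>2 * b1 * b2 * Q)"
    using gevrey_bound_mono K by blast
  from result[OF this] show "(\<lambda>x. 1 / opnorm (E x)) \<in> gevrey s K' I"
    "gevrey_norm s K' I (\<lambda>x. 1 / opnorm (E x)) \<le> ennreal (C\<^sup>2) *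
      gevrey_norm s K I (\<lambda>x. 1 / e1 x) * gevrey_norm s K I (\<lambda>x. 1 / e2 x) * ennreal Q"
    using nonneg Q by (simp_all add: norms ennreal_mult)
  \<comment> \<open>Brings a bound by the norm \<open>b\<close> of a reciprocal into the form asked for in the angle estimates.\<close>
  have cube: "b \<le> b ^ 3 * a\<^sup>2" if "?bnd f a" "?bnd (\<lambda>x. 1 / f x) b" "\<And>x. x \<in> I \<Longrightarrow> 0 < f x" for f a b
  proof -
    obtain x where x: "x \<in> I" using nonempty by auto
    have b: "0 \<le> b" using gevrey_bound_nonneg[OF K(1) that(2)] .
    have "1 = f x * (1 / f x)"
      using that(3)[OF x] by simp
    also have "\<dots> \<le> a * b"
      using abs_le[OF that(1) x] abs_le[OF that(2) x] that(3)[OF x] by (intro mult_mono) auto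
    finally have "1 \<le> (a * b)\<^sup>2" by (rule one_le_power)
    then have "b * 1 \<le> b * (a * b)\<^sup>2"
      using b by (intro mult_left_mono)
    then show ?thesis
      by (simp add: power2_eq_square power3_eq_cube ac_simps)
  qed
  have gap_pos: "0 < 1 + g x" if "?bnd g (1 / 500)" "x \<in> I" for g x
    using abs_le[OF that] by linarith
  have "?bnd (\<lambda>x. pi / 2 - s_angle (E x)) b1"
  proof (rule gevrey_bound_cong[OF gevrey_bound_double_angle[OF s K(1) tan y z T T2 b1 b_le(1)]])
    fix x assume x: "x \<in> I"
    show "arctan (double_angle_tangent (tan (\<theta> x)) (1 / e1 x) (1 / e2 x)) / 2 = pi / 2 - s_angle (E x)"
      unfolding E_def
      by (rule s_angle_diag_rot_diag[OF pos[OF x] cos[OF x], symmetric],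
          rule gap_pos[OF gevrey_bound_gap_distortion[OF s K(1) tan y z T T2] x])
  qed
  from result[OF gevrey_bound_mono[OF this cube[OF a1 b1 pos(1)] K(1)]]
  show "(\<lambda>x. pi / 2 - s_angle (E x)) \<in> gevrey s K' I"
    "gevrey_norm s K' I (\<lambda>x. pi / 2 - s_angle (E x))
      \<le> gevrey_norm s K I (\<lambda>x. 1 / e1 x) ^ 3 * gevrey_norm s K I e1 ^ 2"
    using nonneg by (simp_all add: norms ennreal_mult ennreal_power)
  have "?bnd (\<lambda>x. u_angle (E x)) b2"
  proof (rule gevrey_bound_cong[OF gevrey_bound_double_angle[OF s K(1) tan z y T T2 b2 b_le(2)]])
    fix x assume x: "x \<in> I"
    show "arctan (double_angle_tangent (tan (\<theta> x)) (1 / e2 x) (1 / e1 x)) / 2 = u_angle (E x)"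
      unfolding E_def
      by (rule u_angle_diag_rot_diag[OF pos[OF x] cos[OF x], symmetric],
          rule gap_pos[OF gevrey_bound_gap_distortion[OF s K(1) tan z y T T2] x])
  qed
  from result[OF gevrey_bound_mono[OF this cube[OF a2 b2 pos(2)] K(1)]]
  show "(\<lambda>x. u_angle (E x)) \<in> gevrey s K' I"
    "gevrey_norm s K' I (\<lambda>x. u_angle (E x))
      \<le> gevrey_norm s K I (\<lambda>x. 1 / e2 x) ^ 3 * gevrey_norm s K I e2 ^ 2"
    using nonneg by (simp_all add: norms ennreal_mult ennreal_power)
qed

section \<open>Smallness from bounded type\<close>

lemma cf_complete_irrational:
  assumes "\<alpha> \<notin> \<rat>"
  shows "cf_complete \<alpha> n \<notin> \<rat>"
proof (induction n)
  case (Suc n)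
  have "frac (cf_complete \<alpha> n) \<notin> \<rat>"
  proof
    assume "frac (cf_complete \<alpha> n) \<in> \<rat>"
    then have "frac (cf_complete \<alpha> n) + of_int \<lfloor>cf_complete \<alpha> n\<rfloor> \<in> \<rat>"
      by (intro Rats_add) auto
    then show False using Suc by (simp add: frac_def)
  qed
  then show ?case
    using Rats_inverse[of "1 / frac (cf_complete \<alpha> n)"] by (auto simp: inverse_eq_divide)
qed (use assms in simp)

lemma cf_partial_Suc_ge_1:
  assumes "\<alpha> \<notin> \<rat>"
  shows "1 \<le> cf_partial \<alpha> (Suc n)"
proof -
  have "frac (cf_complete \<alpha> n) \<noteq> 0"
    using cf_complete_irrational[OF assms, of n] by (auto simp: frac_eq_0_iff Ints_def)
  then have "0 < frac (cf_complete \<alpha> n)"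
    using frac_ge_0[of "cf_complete \<alpha> n"] by linarith
  then have "1 \<le> 1 / frac (cf_complete \<alpha> n)"
    using frac_lt_1[of "cf_complete \<alpha> n"] by simp
  then show ?thesis
    by (simp add: cf_partial_def le_floor_iff)
qed

lemma cf_denom_ge_1:
  assumes "\<alpha> \<notin> \<rat>"
  shows "1 \<le> cf_denom \<alpha> n"
proof (induction n rule: induct_nat_012)
  case (ge2 n)
  have "1 * 1 \<le> cf_partial \<alpha> (Suc (Suc n)) * cf_denom \<alpha> (Suc n)"
    using ge2 cf_partial_Suc_ge_1[OF assms, of "Suc n"] by (intro mult_mono) auto
  then show ?case
    using ge2 by simp
qed (use cf_partial_Suc_ge_1[OF assms, of 0] in simp_all)

text \<open>
  With \<open>q = q\<^sub>n\<^sub>-\<^sub>1 \<ge> 1\<close> one has \<open>q\<^sub>n\<^sup>\<gamma> \<le> q\<^sub>n \<le> (1 + M) q\<close>, so after multiplication by \<open>L\<close> all factors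
  other than the power of \<open>\<lambda>\<close> are at most the \<open>q\<close>-th power of the constant
  \<open>B = L C\<^sup>3 exp(2(1 + M))\<close>. Therefore \<open>\<lambda> \<ge> B\<^sup>3\<close> suffices for every \<open>n\<close>.
\<close>
lemma bounded_type_small_parameter:
  fixes C \<gamma> :: real
  assumes "bounded_type \<alpha>" "0 < \<gamma>" "\<gamma> < 1" "1 \<le> C" "1 \<le> L"
  shows "\<exists>lam0>1. \<forall>lam\<ge>lam0. \<forall>n\<ge>1.
    (C * exp (real_of_int (cf_denom \<alpha> n) powr \<gamma>))\<^sup>2 *
      (C * lam powr (- real_of_int (cf_denom \<alpha> (n - 1)) / 3)) \<le> 1 / L"
proof -
  obtain M where M: "0 < M"
      "\<And>n. real_of_int (cf_denom \<alpha> (Suc n)) \<le> M * real_of_int (cf_denom \<alpha> n)"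
    and irr: "\<alpha> \<notin> \<rat>"
    using assms(1) unfolding bounded_type_def by blast
  define B where "B = L * C ^ 3 * exp (2 * (1 + M))"
  have "1 \<le> C ^ 3" using assms(4) by (rule one_le_power)
  then have LC: "1 \<le> L * C ^ 3"
    using assms(5) mult_mono[of 1 L 1 "C ^ 3"] by simp
  moreover have "1 < exp (2 * (1 + M))" using M(1) by simp
  ultimately have B: "1 < B"
    unfolding B_def using mult_le_less_imp_less[of 1 "L * C ^ 3" 1 "exp (2 * (1 + M))"]
    by simp
  show ?thesis
  proof (intro exI[of _ "B ^ 3"] conjI allI impI)
    show "1 < B ^ 3" using B by simp
  next
    fix lam :: real and n :: nat
    assume lam: "B ^ 3 \<le> lam" and n: "1 \<le> n"
    define q where "q = real_of_int (cf_denom \<alpha> (n - 1))"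
    define q' where "q' = real_of_int (cf_denom \<alpha> n)"
    have q: "1 \<le> q" and q': "1 \<le> q'"
      using cf_denom_ge_1[OF irr] by (simp_all add: q_def q'_def)
    have "q' \<le> M * q"
      using M(2)[of "n - 1"] n by (simp add: q_def q'_def)
    have "q' powr \<gamma> \<le> q' powr 1"
      using q' assms(3) by (intro powr_mono) auto
    also have "q' powr 1 \<le> (1 + M) * q"
      using \<open>q' \<le> M * q\<close> q q' by (simp add: distrib_right)
    finally have E: "exp (q' powr \<gamma>) \<le> exp ((1 + M) * q)" by simp
    have "(exp (q' powr \<gamma>))\<^sup>2 \<le> (exp ((1 + M) * q))\<^sup>2"
      using E by (rule power_mono) simp
    also have "\<dots> = exp (2 * (1 + M)) powr q"
      by (simp add: powr_def power2_eq_square flip: exp_add)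
    finally have E2: "(exp (q' powr \<gamma>))\<^sup>2 \<le> exp (2 * (1 + M)) powr q" .
    have "L * C ^ 3 = (L * C ^ 3) powr 1"
      using LC by simp
    also have "\<dots> \<le> (L * C ^ 3) powr q"
      using LC q by (intro powr_mono) auto
    finally have "L * C ^ 3 * (exp (q' powr \<gamma>))\<^sup>2 \<le> (L * C ^ 3) powr q * exp (2 * (1 + M)) powr q"
      by (intro mult_mono E2) (simp_all add: mult_nonneg_nonneg)
    also have "\<dots> = B powr q"
      using LC by (simp add: B_def powr_mult)
    also have "\<dots> = (B ^ 3) powr (q / 3)"
      using B powr_powr[of B 3 "q / 3"] powr_numeral[of B "Num.Bit1 Num.One"] by simp
    also have "\<dots> \<le> lam powr (q / 3)"
      using lam B q by (intro powr_mono2) auto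
    finally have main: "L * C ^ 3 * (exp (q' powr \<gamma>))\<^sup>2 \<le> lam powr (q / 3)" .
    have "0 < lam" using lam B by (smt (verit) zero_less_power)
    have "L * ((C * exp (q' powr \<gamma>))\<^sup>2 * (C * lam powr (- q / 3)))
        = (L * C ^ 3 * (exp (q' powr \<gamma>))\<^sup>2) * lam powr (- q / 3)"
      by (simp add: power2_eq_square power3_eq_cube)
    also have "\<dots> \<le> lam powr (q / 3) * lam powr (- q / 3)"
      using main by (rule mult_right_mono) simp
    also have "\<dots> = 1"
      using \<open>0 < lam\<close> by (simp flip: powr_add)
    finally have "(C * exp (q' powr \<gamma>))\<^sup>2 * (C * lam powr (- q / 3)) * L \<le> 1"
      by (simp add: mult.commute)
    then show "(C * exp (real_of_int (cf_denom \<alpha> n) powr \<gamma>))\<^sup>2 *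
        (C * lam powr (- real_of_int (cf_denom \<alpha> (n - 1)) / 3)) \<le> 1 / L"
      using assms(5) unfolding q_def[symmetric] q'_def[symmetric] by (subst pos_le_divide_eq) auto
  qed
qed

section \<open>The estimates with uniform constants\<close>

theorem lemma4p1:
  shows "\<exists>C0>0. \<exists>C1>0.
    \<forall>(s::real) (\<gamma>::real) (K::real) (\<alpha>::real) (C::real) (c::real).
      2 < s \<and> 0 < \<gamma> \<and> \<gamma> < 1 \<and> 0 < K \<and> bounded_type \<alpha> \<and> C0 \<le> C \<and> 0 < c \<longrightarrow>
      (\<exists>lam0>1. \<exists>c'>0. \<forall>lam\<ge>lam0. \<forall>n\<ge>1.
        \<forall>(I::real set) (e1::real \<Rightarrow> real) (e2::real \<Rightarrow> real) (\<theta>::real \<Rightarrow> real).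
          let q = (\<lambda>m. real_of_int (cf_denom \<alpha> m));
              Q = exp (q n powr \<gamma>);
              \<eta> = lam powr (- q (n - 1) / 4000);
              E = (\<lambda>x. diag2 (e2 x) (1 / e2 x) ** rot2 (\<theta> x) ** diag2 (e1 x) (1 / e1 x));
              e = (\<lambda>x. opnorm (E x));
              N = gevrey_norm s K I;
              N' = gevrey_norm s ((1 + \<eta>) * K) I;
              G' = gevrey s ((1 + \<eta>) * K) I
          in
          is_interval I \<and> interior I \<noteq> {} \<and>
          e1 \<in> gevrey s K I \<and> e2 \<in> gevrey s K I \<and> \<theta> \<in> gevrey s K I \<and>
          (\<forall>x\<in>I. 0 < e1 x \<and> 0 < e2 x) \<and>
          (\<forall>x\<in>I. cos (\<theta> x) \<noteq> 0 \<and> sin (\<theta> x) \<noteq> 0) \<and>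
          (INF x\<in>I. \<bar>\<theta> x - pi / 2\<bar>) \<ge> c / Q \<and>
          c / Q \<ge> C1 * min (INF x\<in>I. e1 x) (INF x\<in>I. e2 x) powr (- 1 / 100) \<and>
          N (\<lambda>x. 1 / cos (\<theta> x)) \<le> ennreal (C * Q) \<and>
          N (\<lambda>x. tan (\<theta> x)) \<le> ennreal (C * Q) \<and>
          N (\<lambda>x. cos (\<theta> x)) \<le> ennreal C \<and>
          N (\<lambda>x. cot (\<theta> x)) \<le> ennreal C \<and>
          N (\<lambda>x. 1 / e1 x) \<le> ennreal (C * lam powr (- q (n - 1) / 3)) \<and>
          N (\<lambda>x. 1 / e2 x) \<le> ennreal (C * lam powr (- q (n - 1) / 3))
          \<longrightarrow>
          (INF x\<in>I. e x) \<ge> c' * (INF x\<in>I. e1 x) * (INF x\<in>I. e2 x) / Q \<and>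
          e \<in> G' \<and> N' e \<le> ennreal (C\<^sup>2) * N e1 * N e2 \<and>
          (\<lambda>x. 1 / e x) \<in> G' \<and>
          N' (\<lambda>x. 1 / e x) \<le> ennreal (C\<^sup>2) * N (\<lambda>x. 1 / e1 x) * N (\<lambda>x. 1 / e2 x) * ennreal Q \<and>
          (\<forall>x\<in>I. 1 < e x) \<and>
          (\<lambda>x. pi / 2 - s_angle (E x)) \<in> G' \<and>
          N' (\<lambda>x. pi / 2 - s_angle (E x)) \<le> N (\<lambda>x. 1 / e1 x) ^ 3 * N e1 ^ 2 \<and>
          (\<lambda>x. u_angle (E x)) \<in> G' \<and>
          N' (\<lambda>x. u_angle (E x)) \<le> N (\<lambda>x. 1 / e2 x) ^ 3 * N e2 ^ 2)"
proof (rule exI[of _ 23], rule conjI, simp, rule exI[of _ 1], rule conjI, simp,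
    intro allI impI, goal_cases)
  case (1 s \<gamma> K \<alpha> C c)
  then have s: "1 \<le> s" and \<gamma>: "0 < \<gamma>" "\<gamma> < 1" and K: "0 < K"
    and \<alpha>: "bounded_type \<alpha>" and C: "23 \<le> C"
    by auto
  obtain lam0 where "1 < lam0" and small: "\<And>lam n. lam0 \<le> lam \<Longrightarrow> 1 \<le> n \<Longrightarrow>
      (C * exp (real_of_int (cf_denom \<alpha> n) powr \<gamma>))\<^sup>2 *
        (C * lam powr (- real_of_int (cf_denom \<alpha> (n - 1)) / 3)) \<le> 1 / 2000"
    using bounded_type_small_parameter[OF \<alpha> \<gamma>, of C 2000] C by auto
  show ?case
  proof (rule exI[of _ lam0], rule conjI, fact, rule exI[of _ "1 / (2 * C)"], rule conjI,
      use C in simp, intro allI impI, goal_cases)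
    case (1 lam n I e1 e2 \<theta>)
    have K': "K \<le> (1 + lam powr (- real_of_int (cf_denom \<alpha> (n - 1)) / 4000)) * K"
      using K by (simp add: distrib_right)
    have Q: "1 \<le> exp (real_of_int (cf_denom \<alpha> n) powr \<gamma>)"
      by simp
    have \<epsilon>: "0 \<le> C * lam powr (- real_of_int (cf_denom \<alpha> (n - 1)) / 3)"
      using C by simp
    show ?case
      unfolding Let_def
    proof (rule impI, elim conjE, goal_cases)
      case 1
      interpret nondegenerate_interval I
        by unfold_locales fact+
      note estimates = product_estimates[OF s K K' C Q small[OF \<open>lam0 \<le> lam\<close> \<open>1 \<le> n\<close>]
        \<open>e1 \<in> _\<close> \<open>e2 \<in> _\<close> \<open>\<theta> \<in> _\<close>]
      show ?case
        using 1 by (intro conjI estimates \<epsilon>) auto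
    qed
  qed
qed

end
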